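(* Let $(\alpha,\beta)\in\mathbb{N}^2\setminus\{(0,0)\}$ and let $(U^{CT}(t))_{t\ge 0}$ be the continuous-time urn process (defined in the context) started from $U^{CT}(0)=(\alpha,\beta)$. There exist real-valued random variables $\xi$ and $W^{CT}$ such that, as $t\to+\infty$, $$U^{CT}(t)=e^{St}\,\xi\, v_1\,(1+o(1))+e^{mt}\,W^{CT}\,v_2\,(1+o(1)),$$ where the little $o$'s hold almost surely and in every $L^p$, $p\ge 1$; this means that the coordinates $u_1(U^{CT}(t))$ and $u_2(U^{CT}(t))$ of $U^{CT}(t)$ in the basis $(v_1,v_2)$ satisfy $$e^{-St}u_1(U^{CT}(t))\longrightarrow \xi ,\qquad e^{-mt}u_2(U^{CT}(t))\longrightarrow W^{CT}$$ almost surely and in $L^p$ for every $p\ge 1$. Furthermore, $\xi$ is $\mathrm{Gamma}(u/S)$-distributed, where $u=\alpha+\beta$ is the total number of balls at time $0$.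
   Context: Standing assumptions (balanced, large, nontriangular urn): $m,S,b$ are integers with $m+2\le S\le 2m-1$ and $1\le b\le S-m-1$; put $a=S-b$, $c=S-m-b$, $d=m+b$. The replacement matrix is $R=\begin{pmatrix}a&b\\ c&d\end{pmatrix}$, with nonnegative integer entries, $a+b=c+d=S$, and eigenvalues $S$ and $m=a-c=d-b$, with $1/2<m/S<1$. Continuous-time urn process: the Markov jump process on $\mathbb{N}^2\setminus\{(0,0)\}$ which, from a state $(x,y)$, jumps to $(x+a,y+b)$ at rate $x$ and to $(x+c,y+d)$ at rate $y$ (each of the $x$ red and $y$ black balls carries an independent exponential clock of parameter $1$; when a red ball's clock rings, $a$ red and $b$ black balls are added; when a black ball's clock rings, $c$ red and $d$ black balls are added). Linear forms and vectors: $u_1(x,y)=\frac1S(x+y)$, $u_2(x,y)=\frac1S(bx-cy)$; the dual basis is $v_1=\frac{S}{b+c}\begin{pmatrix}c\\ b\end{pmatrix}$, $v_2=\frac{S}{b+c}\begin{pmatrix}1\\ -1\end{pmatrix}$, so that $v=u_1(v)v_1+u_2(v)v_2$ for all $v$. $\mathrm{Gamma}(r)$ denotes the distribution with density $x^{r-1}e^{-x}/\Gamma(r)$ on $(0,\infty)$. *)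

theory Defs
  imports "HOL-Probability.Probability"
begin

section \<open>Continuous-time Markov jump processes\<close>

text \<open>\<open>q z z'\<close> is the rate of jumping from \<open>z\<close> to \<open>z'\<close>, for \<open>z' \<noteq> z\<close>; the diagonal is ignored.\<close>

definition total_rate :: "('s \<Rightarrow> 's \<Rightarrow> real) \<Rightarrow> 's \<Rightarrow> real" where
  "total_rate q z = infsum (q z) (- {z})"

definition jump_prob :: "('s \<Rightarrow> 's \<Rightarrow> real) \<Rightarrow> 's \<Rightarrow> 's \<Rightarrow> real" where
  "jump_prob q z z' = (if z' = z then 0 else q z z' / total_rate q z)"

text \<open>
  Jump chain / holding time description of a Markov jump process on \<open>M\<close> with jump rates \<open>q\<close>,
  started at \<open>z0\<close>.  \<open>Y n\<close> is the state after the \<open>n\<close>-th jump and \<open>T n\<close> the time spent there.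
  The product formula says that \<open>Y\<close> is a Markov chain started at \<open>z0\<close> with transition matrix
  \<open>jump_prob q\<close> and that, given \<open>Y 0, \<dots>, Y n\<close>, the times \<open>T 0, \<dots>, T (n - 1)\<close> are independent,
  \<open>T i\<close> being exponential of parameter \<open>total_rate q (Y i)\<close>.
  The path is prescribed up to null sets and, for rates allowing explosion, only before the
  explosion time; \<open>U t\<close> is unconstrained for \<open>t < 0\<close>.
  As the holding times are finite, absorbing states (total rate \<open>0\<close>) must not be reachable.
\<close>

definition markov_jump_process ::
    "'w measure \<Rightarrow> ('s::countable \<Rightarrow> 's \<Rightarrow> real) \<Rightarrow> 's \<Rightarrow> (real \<Rightarrow> 'w \<Rightarrow> 's) \<Rightarrow> bool" where
  "markov_jump_process M q z0 U \<longleftrightarrow>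
     prob_space M \<and>
     (\<forall>t\<ge>0. U t \<in> measurable M (count_space UNIV)) \<and>
     (\<exists>Y T.
        (\<forall>n::nat. Y n \<in> measurable M (count_space UNIV)) \<and>
        (\<forall>n::nat. T n \<in> borel_measurable M) \<and>
        (\<forall>n y s. (\<forall>i<n. 0 \<le> s i) \<longrightarrow>
           measure M {\<omega> \<in> space M. (\<forall>i\<le>n. Y i \<omega> = y i) \<and> (\<forall>i<n. s i < T i \<omega>)} =
             (if y 0 = z0 then 1 else 0) *
             (\<Prod>i<n. jump_prob q (y i) (y (Suc i)) * exp (- total_rate q (y i) * s i))) \<and>
        (AE \<omega> in M. \<forall>n t. (\<Sum>i<n. T i \<omega>) \<le> t \<and> t < (\<Sum>i<Suc n. T i \<omega>) \<longrightarrow> U t \<omega> = Y n \<omega>))"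


section \<open>The two-colour urn with replacement matrix \<open>(a, b; c, d)\<close>\<close>

definition urn_rate :: "int \<Rightarrow> int \<Rightarrow> int \<Rightarrow> int \<Rightarrow> nat \<times> nat \<Rightarrow> nat \<times> nat \<Rightarrow> real" where
  "urn_rate a b c d z z' =
     (if int (fst z') = int (fst z) + a \<and> int (snd z') = int (snd z) + b then real (fst z) else 0) +
     (if int (fst z') = int (fst z) + c \<and> int (snd z') = int (snd z) + d then real (snd z) else 0)"

definition urn_process_CT ::
    "'w measure \<Rightarrow> int \<Rightarrow> int \<Rightarrow> int \<Rightarrow> int \<Rightarrow> nat \<times> nat \<Rightarrow> (real \<Rightarrow> 'w \<Rightarrow> nat \<times> nat) \<Rightarrow> bool" where
  "urn_process_CT M a b c d z0 U \<longleftrightarrow> markov_jump_process M (urn_rate a b c d) z0 U"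

definition vec2 :: "nat \<times> nat \<Rightarrow> real \<times> real" where
  "vec2 z = (real (fst z), real (snd z))"

definition u1 :: "int \<Rightarrow> real \<times> real \<Rightarrow> real" where
  "u1 S v = (fst v + snd v) / S"

definition u2 :: "int \<Rightarrow> int \<Rightarrow> int \<Rightarrow> real \<times> real \<Rightarrow> real" where
  "u2 S b c v = (b * fst v - c * snd v) / S"

definition v1 :: "int \<Rightarrow> int \<Rightarrow> int \<Rightarrow> real \<times> real" where
  "v1 S b c = (S / (b + c)) *\<^sub>R (real_of_int c, real_of_int b)"

definition v2 :: "int \<Rightarrow> int \<Rightarrow> int \<Rightarrow> real \<times> real" where
  "v2 S b c = (S / (b + c)) *\<^sub>R (1, - 1)"


section \<open>Modes of convergence and the Gamma distribution\<close>

definition in_Lp :: "'w measure \<Rightarrow> real \<Rightarrow> ('w \<Rightarrow> real) \<Rightarrow> bool" where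
  "in_Lp M p f \<longleftrightarrow> f \<in> borel_measurable M \<and> integrable M (\<lambda>\<omega>. \<bar>f \<omega>\<bar> powr p)"

definition converges_AE :: "'w measure \<Rightarrow> (real \<Rightarrow> 'w \<Rightarrow> real) \<Rightarrow> ('w \<Rightarrow> real) \<Rightarrow> bool" where
  "converges_AE M X Z \<longleftrightarrow> (AE \<omega> in M. ((\<lambda>t. X t \<omega>) \<longlongrightarrow> Z \<omega>) at_top)"

definition converges_Lp :: "'w measure \<Rightarrow> real \<Rightarrow> (real \<Rightarrow> 'w \<Rightarrow> real) \<Rightarrow> ('w \<Rightarrow> real) \<Rightarrow> bool" where
  "converges_Lp M p X Z \<longleftrightarrow>
     (\<forall>t\<ge>0. in_Lp M p (X t)) \<and> in_Lp M p Z \<and>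
     ((\<lambda>t. \<integral>\<^sup>+\<omega>. ennreal (\<bar>X t \<omega> - Z \<omega>\<bar> powr p) \<partial>M) \<longlongrightarrow> 0) at_top"

definition gamma_density :: "real \<Rightarrow> real \<Rightarrow> real" where
  "gamma_density r x = (if 0 < x then x powr (r - 1) * exp (- x) / Gamma r else 0)"

end

theory Submission
  imports Defs
begin

text \<open>
  Write \<open>u\<close> for the initial number of balls, \<open>r = u / S\<close> and \<open>\<sigma> = m / S\<close>, so that
  \<open>1 / 2 < \<sigma> < 1\<close>.  As every jump adds \<open>S\<close> balls, there are \<open>S * (r + n)\<close> balls
  after \<open>n\<close> jumps, whatever their colours.  The holding times \<open>T i\<close> are therefore independent
  exponential variables of parameters \<open>S * (r + i)\<close>, and the process is the jump chain \<open>Y\<close> read at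
  the number \<open>N t\<close> of jumps before time \<open>t\<close>, with \<open>u\<^sub>1 (U t) = r + N t\<close>.

  \<^bold>\<open>First coordinate.\<close>  Let \<open>\<tau> n\<close> be the time of the \<open>n\<close>-th jump.  The sums
  \<open>S * \<tau> n - ln ((r + n) / r)\<close> have independent increments whose variances are of order
  \<open>1 / n\<^sup>2\<close>, hence \<open>ln (r + n) - S * \<tau> n\<close> converges almost surely to some \<open>L\<close>
  (\<open>jump_time_converges\<close>); inverting \<open>\<tau>\<close> gives \<open>exp (- S t) * u\<^sub>1 (U t) \<longlongrightarrow> exp L\<close>
  (\<open>counting_function\<close>).  The Fourier transform of \<open>L\<close> is the limit of
  \<open>n powr (i\<theta>) * (\<Prod>j\<le>n. (r + j) / (r + j + i\<theta>))\<close>, which by Gauss's product is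
  \<open>Gamma (r + i\<theta>) / Gamma r\<close>, the Fourier transform of the logarithm of a \<open>Gamma(r)\<close> variable.

  \<^bold>\<open>Second coordinate.\<close>  Along the jump chain, \<open>u\<^sub>2 (Y n)\<close> divided by
  \<open>growth n = (\<Prod>i<n. 1 + \<sigma> / (r + i)) \<sim> g * (r + n) powr \<sigma>\<close> is a martingale whose \<open>n\<close>-th increment
  is of order \<open>n powr - \<sigma>\<close>.  This is square summable because \<open>\<sigma> > 1 / 2\<close>, so the martingale
  converges to some \<open>W\<close> (\<open>Mart_converges\<close>), and
  \<open>exp (- m t) * u\<^sub>2 (U t) = (exp (- S t) * u\<^sub>1 (U t)) powr \<sigma> * (growth (N t) / (r + N t) powr \<sigma>) * Mart (N t)\<close>
  tends to \<open>(exp L) powr \<sigma> * g * W\<close>.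

  Both almost sure limits come from \<open>convergence_of_exp_increments\<close>, which derives convergence from a
  bound on the exponential moments of increments; such a bound is explicit for exponential variables
  and follows from Hoeffding's lemma for the martingale.  Besides the limit it gives an integrable
  bound for the powers of the whole sequence, which controls the moments of \<open>Mart (N t)\<close> at the random
  index \<open>N t\<close>.  The moments of the
  first coordinate come from Markov's inequality for \<open>exp (- q * S * \<tau> n)\<close> (\<open>jump_time_tail\<close>).
  Bounded moments of all orders upgrade almost sure convergence to convergence in every
  \<open>L\<^sup>p\<close> (\<open>converges_Lp_of_bounded_even_moments\<close>).
\<close>

section \<open>Almost sure convergence from exponential moments of increments\<close>

lemma power_even_le_exp:
  fixes x :: real
  shows "x ^ (2 * k) \<le> fact (2 * k) * (exp x + exp (- x))"
proof -
  have *: "y ^ n / fact n \<le> exp y" if "0 \<le> y" for y :: real and n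
  proof -
    have "(\<Sum>i\<in>{n}. y ^ i /\<^sub>R fact i) \<le> (\<Sum>i. y ^ i /\<^sub>R fact i)"
      using that by (intro sum_le_suminf summable_exp_generic) auto
    then show ?thesis
      by (simp add: exp_def divide_inverse mult.commute)
  qed
  have "x ^ (2 * k) = \<bar>x\<bar> ^ (2 * k)" by (simp add: power_mult)
  also have "\<dots> \<le> fact (2 * k) * exp \<bar>x\<bar>"
    using *[of "\<bar>x\<bar>" "2 * k"] by (simp add: field_simps)
  also have "\<dots> \<le> fact (2 * k) * (exp x + exp (- x))"
    by (intro mult_left_mono) (auto simp: abs_if)
  finally show ?thesis .
qed

lemma power_even_add_le:
  fixes x y :: real
  shows "(x + y) ^ (2 * k) \<le> 2 ^ (2 * k) * (x ^ (2 * k) + y ^ (2 * k))"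
proof -
  have "(x + y) ^ (2 * k) = \<bar>x + y\<bar> ^ (2 * k)" by (simp add: power_mult)
  also have "\<dots> \<le> (2 * max \<bar>x\<bar> \<bar>y\<bar>) ^ (2 * k)"
    by (intro power_mono) auto
  also have "\<dots> = 2 ^ (2 * k) * max \<bar>x\<bar> \<bar>y\<bar> ^ (2 * k)"
    by (simp add: power_mult_distrib)
  also have "max \<bar>x\<bar> \<bar>y\<bar> ^ (2 * k) \<le> \<bar>x\<bar> ^ (2 * k) + \<bar>y\<bar> ^ (2 * k)"
    by (auto simp: max_def)
  finally show ?thesis by (simp add: power_mult)
qed

text \<open>
  Fatou's lemma, in the form in which bounds on moments pass to almost sure limits.
\<close>

lemma nn_integral_limit_le:
  fixes f :: "nat \<Rightarrow> 'a \<Rightarrow> ennreal"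
  assumes [measurable]: "\<And>n. f n \<in> borel_measurable M"
    and lim: "AE \<omega> in M. (\<lambda>n. f n \<omega>) \<longlonglongrightarrow> g \<omega>"
    and le: "eventually (\<lambda>n. (\<integral>\<^sup>+\<omega>. f n \<omega> \<partial>M) \<le> C) sequentially"
  shows "(\<integral>\<^sup>+\<omega>. g \<omega> \<partial>M) \<le> C"
proof -
  have "(\<integral>\<^sup>+\<omega>. g \<omega> \<partial>M) = (\<integral>\<^sup>+\<omega>. liminf (\<lambda>n. f n \<omega>) \<partial>M)"
    by (intro nn_integral_cong_AE) (use lim in \<open>auto simp: lim_imp_Liminf\<close>)
  also have "\<dots> \<le> liminf (\<lambda>n. \<integral>\<^sup>+\<omega>. f n \<omega> \<partial>M)"
    by (intro nn_integral_liminf) auto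
  also have "\<dots> \<le> limsup (\<lambda>n. \<integral>\<^sup>+\<omega>. f n \<omega> \<partial>M)"
    by (intro Liminf_le_Limsup) auto
  also have "\<dots> \<le> C"
    by (rule Limsup_bounded) (rule le)
  finally show ?thesis .
qed

lemma tendsto_zero_powerD:
  fixes f :: "'b \<Rightarrow> real"
  assumes "((\<lambda>x. f x ^ n) \<longlongrightarrow> 0) F" "0 < n"
  shows "(f \<longlongrightarrow> 0) F"
proof -
  have "((\<lambda>x. root n (\<bar>f x ^ n\<bar>)) \<longlongrightarrow> root n \<bar>0\<bar>) F"
    by (intro tendsto_intros assms)
  then show ?thesis
    using \<open>0 < n\<close> by (simp add: power_abs real_root_power_cancel tendsto_rabs_zero_iff)
qed

lemma ennreal_le_suminf:
  fixes f :: "nat \<Rightarrow> ennreal"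
  shows "f j \<le> (\<Sum>j. f j)"
  using sum_le_suminf[OF summableI, of "{j}" f] by simp

context prob_space
begin

text \<open>
  The exponential series bounds \<open>x ^ (2 * k) / (2 * k)!\<close> by \<open>exp x + exp (- x)\<close>, here at \<open>x = l * D\<close>.
\<close>

lemma even_moment_le_of_exp_moments:
  assumes [measurable]: "D \<in> borel_measurable M"
    and "0 < l"
    and "(\<integral>\<^sup>+\<omega>. ennreal (exp (l * D \<omega>)) \<partial>M) \<le> ennreal C"
    and "(\<integral>\<^sup>+\<omega>. ennreal (exp (- (l * D \<omega>))) \<partial>M) \<le> ennreal C"
    and "0 \<le> C"
  shows "(\<integral>\<^sup>+\<omega>. ennreal (D \<omega> ^ (2 * k)) \<partial>M) \<le> ennreal (2 * C * fact (2 * k) / l ^ (2 * k))"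
proof -
  define c :: real where "c = fact (2 * k) / l ^ (2 * k)"
  have c: "0 \<le> c" using \<open>0 < l\<close> by (simp add: c_def)
  have "D \<omega> ^ (2 * k) \<le> c * (exp (l * D \<omega>) + exp (- (l * D \<omega>)))" for \<omega>
    using power_even_le_exp[of "l * D \<omega>" k] \<open>0 < l\<close>
    by (simp add: power_mult_distrib c_def field_simps)
  then have "(\<integral>\<^sup>+\<omega>. ennreal (D \<omega> ^ (2 * k)) \<partial>M) \<le>
      (\<integral>\<^sup>+\<omega>. ennreal (c * (exp (l * D \<omega>) + exp (- (l * D \<omega>)))) \<partial>M)"
    by (intro nn_integral_mono ennreal_leI)
  also have "\<dots> = (\<integral>\<^sup>+\<omega>. ennreal c * (ennreal (exp (l * D \<omega>)) + ennreal (exp (- (l * D \<omega>)))) \<partial>M)"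
    using c by (simp add: ennreal_mult ennreal_plus)
  also have "\<dots> = ennreal c * ((\<integral>\<^sup>+\<omega>. ennreal (exp (l * D \<omega>)) \<partial>M) + (\<integral>\<^sup>+\<omega>. ennreal (exp (- (l * D \<omega>))) \<partial>M))"
    by (simp add: nn_integral_cmult nn_integral_add)
  also have "\<dots> \<le> ennreal c * (ennreal C + ennreal C)"
    by (intro mult_left_mono add_mono assms) auto
  also have "\<dots> = ennreal (c * (C + C))"
    using c \<open>0 \<le> C\<close> by (simp add: ennreal_mult ennreal_plus del: mult_2 flip: mult_2)
  also have "c * (C + C) = 2 * C * fact (2 * k) / l ^ (2 * k)"
    by (simp add: c_def)
  finally show ?thesis .
qed

text \<open>
  The hypothesis makes the \<open>2 k\<close>-th moment of \<open>X n - X j\<close> at most a constant times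
  \<open>j powr (- 2 * k * \<delta>)\<close>, for every \<open>k\<close>.  The case \<open>k = 1\<close> makes the increments of \<open>X\<close> along the
  powers of two summable and provides a limit \<open>X'\<close>, to which the moment bounds extend by Fatou's lemma.
  As soon as \<open>k * \<delta> \<ge> 1\<close>, they are summable in \<open>j\<close>: the sum of all \<open>(X j - X') ^ (2 * k)\<close> is
  integrable, so its terms tend to \<open>0\<close> almost surely and it bounds them simultaneously.
\<close>

lemma convergence_of_exp_increments:
  fixes X :: "nat \<Rightarrow> 'a \<Rightarrow> real"
  assumes [measurable]: "\<And>n. X n \<in> borel_measurable M"
    and "0 < \<kappa>" "0 < \<delta>" "0 \<le> C"
    and exp_le: "\<And>s j n. j \<le> n \<Longrightarrow> s \<in> {-1, 1} \<Longrightarrow>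
      (\<integral>\<^sup>+\<omega>. ennreal (exp (s * (\<kappa> * real (Suc j) powr \<delta>) * (X n \<omega> - X j \<omega>))) \<partial>M) \<le> ennreal C"
  obtains X' k0 D where "X' \<in> borel_measurable M"
    and "AE \<omega> in M. (\<lambda>n. X n \<omega>) \<longlonglongrightarrow> X' \<omega>"
    and "\<And>k::nat. D k \<in> borel_measurable M"
    and "\<And>k. k0 \<le> k \<Longrightarrow> (\<integral>\<^sup>+\<omega>. D k \<omega> \<partial>M) < \<infinity>"
    and "\<And>n k \<omega>. ennreal ((X n \<omega> - X 0 \<omega>) ^ (2 * k)) \<le> D k \<omega>"
proof -
  define L where "L j = \<kappa> * real (Suc j) powr \<delta>" for j
  define B where "B k = 2 * C * fact (2 * k)" for k :: nat
  have L: "0 < L j" for j using \<open>0 < \<kappa>\<close> by (simp add: L_def)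
  have B: "0 \<le> B k" for k using \<open>0 \<le> C\<close> by (simp add: B_def)
  have mom: "(\<integral>\<^sup>+\<omega>. ennreal ((X n \<omega> - X j \<omega>) ^ (2 * k)) \<partial>M) \<le> ennreal (B k / L j ^ (2 * k))"
    if "j \<le> n" for j n k
    unfolding B_def using L exp_le[OF that, of 1] exp_le[OF that, of "-1"] \<open>0 \<le> C\<close>
    by (intro even_moment_le_of_exp_moments) (auto simp: L_def)

  \<comment> \<open>Along powers of two, the increments are summable in mean.\<close>
  define q where "q = 2 powr (- \<delta>)"
  have q: "0 < q" "q < 1" using \<open>0 < \<delta>\<close> by (auto simp: q_def powr_less_one)
  have L2: "\<kappa> / q ^ i \<le> L (2 ^ i)" for i
  proof -
    have "1 / q ^ i = (2 ^ i) powr \<delta>"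
      by (simp add: q_def powr_minus powr_powr powr_realpow[symmetric] field_simps)
    also have "\<dots> \<le> real (Suc (2 ^ i)) powr \<delta>"
      using \<open>0 < \<delta>\<close> by (intro powr_mono2) auto
    finally have "\<kappa> * (1 / q ^ i) \<le> \<kappa> * real (Suc (2 ^ i)) powr \<delta>"
      using \<open>0 < \<kappa>\<close> by (intro mult_left_mono) auto
    then show ?thesis by (simp add: L_def)
  qed
  define A where "A = 1 + B 1 / \<kappa>\<^sup>2"
  define \<Delta> where "\<Delta> i \<omega> = X (2 ^ Suc i) \<omega> - X (2 ^ i) \<omega>" for i \<omega>
  have [measurable]: "\<Delta> i \<in> borel_measurable M" for i by (simp add: \<Delta>_def[abs_def])
  have "(\<integral>\<^sup>+\<omega>. ennreal \<bar>\<Delta> i \<omega>\<bar> \<partial>M) \<le> ennreal (A * q ^ i)" for i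
  proof -
    \<comment> \<open>Inequality of arithmetic and geometric means, balanced by the size \<open>q ^ i\<close> of \<open>\<Delta> i\<close> in \<open>L\<^sup>2\<close>.\<close>
    have "\<bar>\<Delta> i \<omega>\<bar> \<le> q ^ i + (1 / q ^ i) * (\<Delta> i \<omega>) ^ (2 * 1)" for \<omega>
    proof -
      have "2 * q ^ i * \<bar>\<Delta> i \<omega>\<bar> \<le> (q ^ i)\<^sup>2 + \<bar>\<Delta> i \<omega>\<bar>\<^sup>2"
        using sum_squares_bound[of "q ^ i" "\<bar>\<Delta> i \<omega>\<bar>"] by simp
      moreover have "q ^ i * \<bar>\<Delta> i \<omega>\<bar> \<ge> 0" using q by simp
      ultimately have "q ^ i * \<bar>\<Delta> i \<omega>\<bar> \<le> (q ^ i)\<^sup>2 + (\<Delta> i \<omega>)\<^sup>2" unfolding power2_abs by linarith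
      then show ?thesis using q by (simp add: field_simps power2_eq_square)
    qed
    then have "(\<integral>\<^sup>+\<omega>. ennreal \<bar>\<Delta> i \<omega>\<bar> \<partial>M) \<le>
        (\<integral>\<^sup>+\<omega>. ennreal (q ^ i) + ennreal (1 / q ^ i) * ennreal ((\<Delta> i \<omega>) ^ (2 * 1)) \<partial>M)"
      using q by (intro nn_integral_mono) (simp flip: ennreal_plus ennreal_mult add: ennreal_leI)
    also have "\<dots> = ennreal (q ^ i) + ennreal (1 / q ^ i) * (\<integral>\<^sup>+\<omega>. ennreal ((\<Delta> i \<omega>) ^ (2 * 1)) \<partial>M)"
      by (subst nn_integral_add) (auto simp: nn_integral_cmult emeasure_space_1)
    also have "\<dots> \<le> ennreal (q ^ i) + ennreal (1 / q ^ i) * ennreal (B 1 / L (2 ^ i) ^ (2 * 1))"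
      unfolding \<Delta>_def by (intro add_mono mult_left_mono mom order_refl) auto
    also have "\<dots> = ennreal (q ^ i + (1 / q ^ i) * (B 1 / L (2 ^ i) ^ (2 * 1)))"
      using q B[of 1] by (simp flip: ennreal_plus ennreal_mult)
    also have "\<dots> \<le> ennreal (q ^ i + (1 / q ^ i) * (B 1 / (\<kappa> / q ^ i) ^ (2 * 1)))"
      using q B[of 1] L2[of i] \<open>0 < \<kappa>\<close> L[of "2 ^ i"]
      by (intro ennreal_leI add_left_mono mult_left_mono divide_left_mono power_mono mult_pos_pos) auto
    also have "q ^ i + (1 / q ^ i) * (B 1 / (\<kappa> / q ^ i) ^ (2 * 1)) = A * q ^ i"
      using q \<open>0 < \<kappa>\<close> by (simp add: A_def field_simps power2_eq_square)
    finally show ?thesis .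
  qed
  moreover have "(\<Sum>i. ennreal (A * q ^ i)) < \<infinity>"
    using q B[of 1] unfolding A_def by (subst suminf_ennreal2) (auto simp: summable_mult summable_geometric)
  ultimately have "(\<Sum>i. \<integral>\<^sup>+\<omega>. ennreal \<bar>\<Delta> i \<omega>\<bar> \<partial>M) < \<infinity>"
    by (meson le_less_trans suminf_le summableI)
  then have "(\<integral>\<^sup>+\<omega>. (\<Sum>i. ennreal \<bar>\<Delta> i \<omega>\<bar>) \<partial>M) \<noteq> \<infinity>"
    by (subst nn_integral_suminf) auto
  then have "AE \<omega> in M. (\<Sum>i. ennreal \<bar>\<Delta> i \<omega>\<bar>) \<noteq> \<infinity>"
    by (intro nn_integral_PInf_AE) auto
  then have conv2: "AE \<omega> in M. convergent (\<lambda>i. X (2 ^ i) \<omega>)"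
  proof eventually_elim
    case (elim \<omega>)
    have "summable (\<lambda>i. \<bar>\<Delta> i \<omega>\<bar>)"
      using elim by (intro summable_suminf_not_top) auto
    then have "summable (\<lambda>i. \<Delta> i \<omega>)" by (rule summable_rabs_cancel)
    then have "convergent (\<lambda>n. \<Sum>i<n. \<Delta> i \<omega>)" by (simp add: summable_iff_convergent)
    moreover have "(\<Sum>i<n. \<Delta> i \<omega>) = X (2 ^ n) \<omega> - X 1 \<omega>" for n
      using sum_lessThan_telescope[of "\<lambda>i. X (2 ^ i) \<omega>" n] by (simp add: \<Delta>_def)
    ultimately have "convergent (\<lambda>n. X 1 \<omega> + (X (2 ^ n) \<omega> - X 1 \<omega>))"
      by (intro convergent_add convergent_const) simp
    then show ?case by simp
  qed
  define X' where "X' \<omega> = lim (\<lambda>i. X (2 ^ i) \<omega>)" for \<omega>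
  have X'[measurable]: "X' \<in> borel_measurable M" by (simp add: X'_def[abs_def])
  have mom': "(\<integral>\<^sup>+\<omega>. ennreal ((X j \<omega> - X' \<omega>) ^ (2 * k)) \<partial>M) \<le> ennreal (B k / L j ^ (2 * k))" for j k
  proof (rule nn_integral_limit_le)
    show "AE \<omega> in M. (\<lambda>i. ennreal ((X j \<omega> - X (2 ^ i) \<omega>) ^ (2 * k))) \<longlonglongrightarrow> ennreal ((X j \<omega> - X' \<omega>) ^ (2 * k))"
      using conv2 by eventually_elim
        (auto intro!: tendsto_ennrealI tendsto_intros simp: X'_def convergent_LIMSEQ_iff)
    have "eventually (\<lambda>i. j \<le> 2 ^ i) sequentially"
      using eventually_ge_at_top[of j]
      by eventually_elim (meson less_exp less_imp_le order_trans)
    then show "eventually (\<lambda>i. (\<integral>\<^sup>+\<omega>. ennreal ((X j \<omega> - X (2 ^ i) \<omega>) ^ (2 * k)) \<partial>M)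
        \<le> ennreal (B k / L j ^ (2 * k))) sequentially"
      by eventually_elim (use mom in \<open>simp add: power_mult power2_commute\<close>)
  qed simp
  define k0 where "k0 = nat \<lceil>1 / \<delta>\<rceil>"
  define E where "E k \<omega> = (\<Sum>j. ennreal ((X j \<omega> - X' \<omega>) ^ (2 * k)))" for k \<omega>
  have E: "(\<integral>\<^sup>+\<omega>. E k \<omega> \<partial>M) < \<infinity>" if "k0 \<le> k" for k
  proof -
    have k: "1 \<le> k * \<delta>" using that \<open>0 < \<delta>\<close> unfolding k0_def
      by (simp add: field_simps nat_le_iff ceiling_le_iff)
    have "ennreal (B k / L j ^ (2 * k)) \<le> ennreal (B k / \<kappa> ^ (2 * k) * inverse ((real (Suc j))\<^sup>2))" for j
    proof -
      have "(real (Suc j))\<^sup>2 = real (Suc j) powr 2" by simp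
      also have "\<dots> \<le> real (Suc j) powr (2 * k * \<delta>)"
        using k by (intro powr_mono) auto
      also have "\<dots> = (real (Suc j) powr \<delta>) ^ (2 * k)"
        by (simp add: powr_powr powr_realpow[symmetric] mult_ac)
      finally have "\<kappa> ^ (2 * k) * (real (Suc j))\<^sup>2 \<le> L j ^ (2 * k)"
        using \<open>0 < \<kappa>\<close> by (simp add: L_def power_mult_distrib del: of_nat_Suc)
      then have "B k / L j ^ (2 * k) \<le> B k / (\<kappa> ^ (2 * k) * (real (Suc j))\<^sup>2)"
        using B L[of j] \<open>0 < \<kappa>\<close> by (intro divide_left_mono mult_pos_pos) auto
      then show ?thesis by (intro ennreal_leI) (simp add: field_simps)
    qed
    then have "(\<Sum>j. \<integral>\<^sup>+\<omega>. ennreal ((X j \<omega> - X' \<omega>) ^ (2 * k)) \<partial>M) \<le>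
        (\<Sum>j. ennreal (B k / \<kappa> ^ (2 * k) * inverse ((real (Suc j))\<^sup>2)))"
      by (intro suminf_le summableI order_trans[OF mom']) auto
    also have "\<dots> < \<infinity>"
      using B[of k] inverse_power_summable[of 2, where 'a=real]
      by (subst suminf_ennreal2)
        (auto intro!: summable_mult summable_Suc_iff[THEN iffD2] simp del: of_nat_Suc)
    finally have "(\<Sum>j. \<integral>\<^sup>+\<omega>. ennreal ((X j \<omega> - X' \<omega>) ^ (2 * k)) \<partial>M) < \<infinity>" .
    then show ?thesis
      unfolding E_def by (subst nn_integral_suminf) auto
  qed
  have Em[measurable]: "E k \<in> borel_measurable M" for k by (simp add: E_def[abs_def])
  have "k0 \<le> Suc k0" by simp
  from E[OF this] have "AE \<omega> in M. E (Suc k0) \<omega> \<noteq> \<infinity>"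
    by (intro nn_integral_PInf_AE) auto
  then have lim: "AE \<omega> in M. (\<lambda>n. X n \<omega>) \<longlonglongrightarrow> X' \<omega>"
  proof eventually_elim
    case (elim \<omega>)
    then have "summable (\<lambda>j. (X j \<omega> - X' \<omega>) ^ (2 * Suc k0))"
      unfolding E_def by (intro summable_suminf_not_top) (auto simp del: mult_Suc_right)
    then have "(\<lambda>j. (X j \<omega> - X' \<omega>) ^ (2 * Suc k0)) \<longlonglongrightarrow> 0" by (rule summable_LIMSEQ_zero)
    then have "(\<lambda>j. X j \<omega> - X' \<omega>) \<longlonglongrightarrow> 0"
      by (rule tendsto_zero_powerD) simp
    then show ?case by (simp add: LIM_zero_iff)
  qed
  define D where "D k \<omega> = 2 ^ (2 * k + 1) * E k \<omega>" for k \<omega>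
  show thesis
  proof (rule that[of X' D k0])
    show "D k \<in> borel_measurable M" for k by (simp add: D_def[abs_def])
    show "(\<integral>\<^sup>+\<omega>. D k \<omega> \<partial>M) < \<infinity>" if "k0 \<le> k" for k
      using E[OF that] by (simp add: D_def nn_integral_cmult ennreal_mult_less_top power_less_top_ennreal)
    show "ennreal ((X n \<omega> - X 0 \<omega>) ^ (2 * k)) \<le> D k \<omega>" for n k \<omega>
    proof -
      have 1: "ennreal ((X j \<omega> - X' \<omega>) ^ (2 * k)) \<le> E k \<omega>" for j
        unfolding E_def by (rule ennreal_le_suminf)
      have "(X n \<omega> - X 0 \<omega>) ^ (2 * k) \<le> 2 ^ (2 * k) * ((X n \<omega> - X' \<omega>) ^ (2 * k) + (X 0 \<omega> - X' \<omega>) ^ (2 * k))"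
        using power_even_add_le[of "X n \<omega> - X' \<omega>" "X' \<omega> - X 0 \<omega>" k]
        by (simp add: power_mult power2_commute)
      then have "ennreal ((X n \<omega> - X 0 \<omega>) ^ (2 * k)) \<le>
          ennreal (2 ^ (2 * k)) * (ennreal ((X n \<omega> - X' \<omega>) ^ (2 * k)) + ennreal ((X 0 \<omega> - X' \<omega>) ^ (2 * k)))"
        by (subst ennreal_plus[symmetric], simp, simp, subst ennreal_mult[symmetric], simp, simp, rule ennreal_leI)
      also have "\<dots> \<le> ennreal (2 ^ (2 * k)) * (E k \<omega> + E k \<omega>)"
        by (intro mult_left_mono add_mono 1) auto
      also have "\<dots> = D k \<omega>" by (simp add: D_def mult_2[symmetric] mult_ac del: mult_2 flip: ennreal_power)
      finally show ?thesis .
    qed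
  qed (use X' lim in auto)
qed

end

section \<open>Convergence of moments\<close>

lemma tendsto_0_of_le_add:
  fixes f :: "nat \<Rightarrow> ennreal"
  assumes "\<And>e::real. 0 < e \<Longrightarrow> \<exists>g. g \<longlonglongrightarrow> 0 \<and> (\<forall>n. f n \<le> g n + ennreal e)"
  shows "f \<longlonglongrightarrow> 0"
proof (rule tendsto_0_if_Limsup_eq_0_ennreal)
  have "limsup f \<le> 0 + ennreal e" if e: "0 < e" for e
  proof -
    obtain g where g: "g \<longlonglongrightarrow> 0" "\<And>n. f n \<le> g n + ennreal e"
      using assms[OF e] by blast
    have "limsup f \<le> limsup (\<lambda>n. g n + ennreal e)"
      by (intro Limsup_mono always_eventually allI g)
    also have "\<dots> = 0 + ennreal e"
      by (intro lim_imp_Limsup tendsto_add g tendsto_const) simp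
    finally show ?thesis .
  qed
  then have "limsup f \<le> 0" by (rule ennreal_le_epsilon)
  then show "limsup f = 0" by simp
qed

context prob_space
begin

text \<open>
  A bound in \<open>L\<^sup>2\<^sup>p\<close> makes the \<open>p\<close>-th powers uniformly integrable.  Even integer moments suffice to
  dominate all real exponents and are what the estimates below produce.
\<close>

lemma converges_Lp_of_bounded_even_moments:
  fixes X :: "real \<Rightarrow> 'a \<Rightarrow> real"
  assumes X[measurable]: "\<And>t. 0 \<le> t \<Longrightarrow> X t \<in> borel_measurable M"
    and [measurable]: "Z \<in> borel_measurable M"
    and lim: "AE \<omega> in M. ((\<lambda>t. X t \<omega>) \<longlongrightarrow> Z \<omega>) at_top"
    and mom: "\<And>k0::nat. \<exists>k\<ge>k0. \<exists>C\<ge>0. \<forall>t\<ge>0. (\<integral>\<^sup>+\<omega>. ennreal (X t \<omega> ^ (2 * k)) \<partial>M) \<le> ennreal C"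
    and "0 < p"
  shows "converges_Lp M p X Z"
proof -
  obtain k C where k: "nat \<lceil>p\<rceil> \<le> k" and "0 \<le> C"
    and C: "\<And>t. 0 \<le> t \<Longrightarrow> (\<integral>\<^sup>+\<omega>. ennreal (X t \<omega> ^ (2 * k)) \<partial>M) \<le> ennreal C"
    using mom by meson
  have kp: "p \<le> k" using k \<open>0 < p\<close> by (simp add: nat_le_iff ceiling_le_iff)
  have powr_le: "\<bar>x\<bar> powr q \<le> 1 + x ^ (2 * k)" if "0 < q" "q \<le> 2 * p" for q x :: real
  proof (cases "\<bar>x\<bar> \<le> 1")
    case True
    then have "\<bar>x\<bar> powr q \<le> 1" using that by (intro powr_le1) auto
    then show ?thesis using zero_le_even_power'[of x k] by linarith
  next
    case False
    then have "\<bar>x\<bar> powr q \<le> \<bar>x\<bar> powr (real (2 * k))"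
      using that kp by (intro powr_mono) auto
    also have "\<dots> = x ^ (2 * k)" using False by (subst powr_realpow) (auto simp: power_mult)
    finally show ?thesis by simp
  qed
  have Z: "(\<integral>\<^sup>+\<omega>. ennreal (Z \<omega> ^ (2 * k)) \<partial>M) \<le> ennreal C"
  proof (rule nn_integral_limit_le)
    show "AE \<omega> in M. (\<lambda>n. ennreal (X (real n) \<omega> ^ (2 * k))) \<longlonglongrightarrow> ennreal (Z \<omega> ^ (2 * k))"
      using lim
    proof eventually_elim
      case (elim \<omega>)
      then have "(\<lambda>n. X (real n) \<omega>) \<longlonglongrightarrow> Z \<omega>"
        by (rule filterlim_compose[OF _ filterlim_real_sequentially])
      then show ?case by (intro tendsto_intros)
    qed
  qed (use C in auto)
  have in_Lp: "in_Lp M p f" if [measurable]: "f \<in> borel_measurable M"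
    and f: "(\<integral>\<^sup>+\<omega>. ennreal (f \<omega> ^ (2 * k)) \<partial>M) \<le> ennreal C" for f
    unfolding in_Lp_def
  proof (intro conjI integrableI_nonneg)
    have "(\<integral>\<^sup>+\<omega>. ennreal (\<bar>f \<omega>\<bar> powr p) \<partial>M) \<le> (\<integral>\<^sup>+\<omega>. 1 + ennreal (f \<omega> ^ (2 * k)) \<partial>M)"
      using powr_le[of p] \<open>0 < p\<close>
      by (intro nn_integral_mono) (auto simp flip: ennreal_1 ennreal_plus intro!: ennreal_leI)
    also have "\<dots> = 1 + (\<integral>\<^sup>+\<omega>. ennreal (f \<omega> ^ (2 * k)) \<partial>M)"
      by (subst nn_integral_add) (auto simp: emeasure_space_1)
    also have "\<dots> < \<infinity>" using f by (auto simp: less_top intro: le_less_trans)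
    finally show "(\<integral>\<^sup>+\<omega>. ennreal (\<bar>f \<omega>\<bar> powr p) \<partial>M) < \<infinity>" .
  qed auto
  define d where "d t \<omega> = X t \<omega> - Z \<omega>" for t \<omega>
  have [measurable]: "d t \<in> borel_measurable M" if "0 \<le> t" for t
    using X[OF that] by (simp add: d_def[abs_def])
  define C' where "C' = 1 + 2 ^ (2 * k) * (C + C)"
  have C': "0 < C'" using \<open>0 \<le> C\<close> by (auto simp: C'_def intro!: add_pos_nonneg)
  have d: "(\<integral>\<^sup>+\<omega>. ennreal (\<bar>d t \<omega>\<bar> powr (2 * p)) \<partial>M) \<le> ennreal C'" if t: "0 \<le> t" for t
  proof -
    note [measurable] = X[OF t]
    have "(\<integral>\<^sup>+\<omega>. ennreal (\<bar>d t \<omega>\<bar> powr (2 * p)) \<partial>M) \<le>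
        (\<integral>\<^sup>+\<omega>. 1 + ennreal (2 ^ (2 * k)) * (ennreal (X t \<omega> ^ (2 * k)) + ennreal (Z \<omega> ^ (2 * k))) \<partial>M)"
    proof (intro nn_integral_mono)
      fix \<omega>
      have "\<bar>d t \<omega>\<bar> powr (2 * p) \<le> 1 + d t \<omega> ^ (2 * k)"
        using powr_le[of "2 * p"] \<open>0 < p\<close> by auto
      also have "\<dots> \<le> 1 + 2 ^ (2 * k) * (X t \<omega> ^ (2 * k) + Z \<omega> ^ (2 * k))"
        using power_even_add_le[of "X t \<omega>" "- Z \<omega>" k] by (simp add: d_def power_mult)
      finally show "ennreal (\<bar>d t \<omega>\<bar> powr (2 * p)) \<le>
          1 + ennreal (2 ^ (2 * k)) * (ennreal (X t \<omega> ^ (2 * k)) + ennreal (Z \<omega> ^ (2 * k)))"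
        by (simp flip: ennreal_1 ennreal_plus ennreal_mult add: ennreal_leI)
    qed
    also have "\<dots> = 1 + ennreal (2 ^ (2 * k)) * ((\<integral>\<^sup>+\<omega>. ennreal (X t \<omega> ^ (2 * k)) \<partial>M) + (\<integral>\<^sup>+\<omega>. ennreal (Z \<omega> ^ (2 * k)) \<partial>M))"
      by (simp add: nn_integral_add nn_integral_cmult emeasure_space_1)
    also have "\<dots> \<le> 1 + ennreal (2 ^ (2 * k)) * (ennreal C + ennreal C)"
      by (intro add_mono mult_left_mono Z C t) auto
    also have "\<dots> = ennreal C'"
      using \<open>0 \<le> C\<close> by (simp add: C'_def flip: ennreal_1 ennreal_plus ennreal_mult del: mult_2)
    finally show ?thesis .
  qed
  have "((\<lambda>t. \<integral>\<^sup>+\<omega>. ennreal (\<bar>X t \<omega> - Z \<omega>\<bar> powr p) \<partial>M) \<longlongrightarrow> 0) at_top"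
  proof (rule tendsto_at_topI_sequentially)
    fix s :: "nat \<Rightarrow> real" assume s: "filterlim s at_top sequentially"
    define t where "t n = max 0 (s n)" for n
    have t0: "0 \<le> t n" for n by (simp add: t_def)
    note [measurable] = X[OF t0]
    have t: "filterlim t at_top sequentially"
      unfolding t_def by (rule filterlim_at_top_mono[OF s]) auto
    have "(\<lambda>n. \<integral>\<^sup>+\<omega>. ennreal (\<bar>d (t n) \<omega>\<bar> powr p) \<partial>M) \<longlonglongrightarrow> 0"
    proof (rule tendsto_0_of_le_add)
      fix e :: real assume e: "0 < e"
      define K where "K = C' / e"
      have K: "0 < K" using C' e by (simp add: K_def)
      \<comment> \<open>Truncate at \<open>K\<close>: the bounded part tends to \<open>0\<close> by dominated convergence, the rest is
        at most \<open>C' / K\<close>.\<close>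
      have 1: "(\<integral>\<^sup>+\<omega>. ennreal (\<bar>d (t n) \<omega>\<bar> powr p) \<partial>M) \<le>
          (\<integral>\<^sup>+\<omega>. ennreal (min K (\<bar>d (t n) \<omega>\<bar> powr p)) \<partial>M) + ennreal e" for n
      proof -
        have "(\<integral>\<^sup>+\<omega>. ennreal (\<bar>d (t n) \<omega>\<bar> powr p) \<partial>M) \<le>
          (\<integral>\<^sup>+\<omega>. ennreal (min K (\<bar>d (t n) \<omega>\<bar> powr p)) + ennreal (1 / K) * ennreal (\<bar>d (t n) \<omega>\<bar> powr (2 * p)) \<partial>M)"
        proof (intro nn_integral_mono)
          fix \<omega>
          let ?x = "\<bar>d (t n) \<omega>\<bar> powr p"
          have "?x \<le> min K ?x + (1 / K) * (?x * ?x)"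
          proof (cases "?x \<le> K")
            case False
            then have "K * ?x \<le> ?x * ?x" by (intro mult_right_mono) auto
            then have "?x \<le> (1 / K) * (?x * ?x)" using K by (simp add: field_simps)
            then show ?thesis using K False by linarith
          qed (use K in auto)
          also have "?x * ?x = \<bar>d (t n) \<omega>\<bar> powr (2 * p)" by (simp flip: powr_add)
          finally show "ennreal ?x \<le> ennreal (min K ?x) + ennreal (1 / K) * ennreal (\<bar>d (t n) \<omega>\<bar> powr (2 * p))"
            using K by (simp flip: ennreal_plus ennreal_mult add: ennreal_leI)
        qed
        also have "\<dots> = (\<integral>\<^sup>+\<omega>. ennreal (min K (\<bar>d (t n) \<omega>\<bar> powr p)) \<partial>M)
            + ennreal (1 / K) * (\<integral>\<^sup>+\<omega>. ennreal (\<bar>d (t n) \<omega>\<bar> powr (2 * p)) \<partial>M)"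
          using t0[of n] by (simp add: nn_integral_add nn_integral_cmult d_def)
        also have "\<dots> \<le> (\<integral>\<^sup>+\<omega>. ennreal (min K (\<bar>d (t n) \<omega>\<bar> powr p)) \<partial>M) + ennreal (1 / K) * ennreal C'"
          by (intro add_left_mono mult_left_mono d t0) auto
        also have "ennreal (1 / K) * ennreal C' = ennreal e"
          using K C' e by (simp flip: ennreal_mult add: K_def)
        finally show ?thesis .
      qed
      have "(\<lambda>n. \<integral>\<^sup>+\<omega>. ennreal (min K (\<bar>d (t n) \<omega>\<bar> powr p)) \<partial>M) \<longlonglongrightarrow> (\<integral>\<^sup>+\<omega>. 0 \<partial>M)"
      proof (rule nn_integral_dominated_convergence[where w = "\<lambda>_. ennreal K"])
        show "AE \<omega> in M. (\<lambda>n. ennreal (min K (\<bar>d (t n) \<omega>\<bar> powr p))) \<longlonglongrightarrow> 0"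
          using lim
        proof eventually_elim
          case (elim \<omega>)
          have "(\<lambda>n. X (t n) \<omega>) \<longlonglongrightarrow> Z \<omega>" by (rule filterlim_compose[OF elim t])
          then have "(\<lambda>n. \<bar>d (t n) \<omega>\<bar>) \<longlonglongrightarrow> 0"
            by (simp add: d_def LIM_zero tendsto_rabs_zero)
          then have "(\<lambda>n. \<bar>d (t n) \<omega>\<bar> powr p) \<longlonglongrightarrow> 0 powr p"
            using \<open>0 < p\<close> by (intro tendsto_powr') auto
          then have "(\<lambda>n. ennreal (min K (\<bar>d (t n) \<omega>\<bar> powr p))) \<longlonglongrightarrow> ennreal (min K 0)"
            by (intro tendsto_ennrealI tendsto_min tendsto_const) simp
          then show ?case using K by simp
        qed
      qed (use K t0 in \<open>auto simp: emeasure_space_1 d_def intro!: ennreal_leI\<close>)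
      then show "\<exists>g. g \<longlonglongrightarrow> 0 \<and> (\<forall>n. (\<integral>\<^sup>+\<omega>. ennreal (\<bar>d (t n) \<omega>\<bar> powr p) \<partial>M) \<le> g n + ennreal e)"
        using 1 by (intro exI[of _ "\<lambda>n. \<integral>\<^sup>+\<omega>. ennreal (min K (\<bar>d (t n) \<omega>\<bar> powr p)) \<partial>M"]) simp
    qed
    then show "(\<lambda>n. \<integral>\<^sup>+\<omega>. ennreal (\<bar>X (s n) \<omega> - Z \<omega>\<bar> powr p) \<partial>M) \<longlonglongrightarrow> 0"
    proof (rule Lim_transform_eventually)
      have "eventually (\<lambda>n. 0 \<le> s n) sequentially"
        using s by (simp add: filterlim_at_top)
      then show "eventually (\<lambda>n. (\<integral>\<^sup>+\<omega>. ennreal (\<bar>d (t n) \<omega>\<bar> powr p) \<partial>M) =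
          (\<integral>\<^sup>+\<omega>. ennreal (\<bar>X (s n) \<omega> - Z \<omega>\<bar> powr p) \<partial>M)) sequentially"
        by eventually_elim (simp add: t_def d_def)
    qed
  qed
  then show ?thesis
    unfolding converges_Lp_def using in_Lp X C Z by auto
qed

text \<open>
  Cut at the integers: \<open>Z ^ k \<le> (n + 2) ^ k\<close> where \<open>n + 1 \<le> Z < n + 2\<close>, and the tail bound leaves the
  summable factor \<open>1 / (n + 1)\<^sup>2\<close>.
\<close>

lemma moment_le_of_tail:
  fixes Z :: "'a \<Rightarrow> real"
  assumes [measurable]: "Z \<in> borel_measurable M"
    and nonneg: "AE \<omega> in M. 0 \<le> Z \<omega>" and "0 \<le> C"
    and tail: "\<And>n::nat. 0 < n \<Longrightarrow> emeasure M {\<omega> \<in> space M. real n \<le> Z \<omega>} \<le> ennreal (C / real n ^ (k + 2))"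
  shows "(\<integral>\<^sup>+\<omega>. ennreal (Z \<omega> ^ k) \<partial>M) \<le> ennreal (1 + 2 ^ k * C * (\<Sum>n. inverse ((real (Suc n))\<^sup>2)))"
proof -
  define A where "A n = {\<omega> \<in> space M. real (Suc n) \<le> Z \<omega>}" for n
  have [measurable]: "A n \<in> sets M" for n by (simp add: A_def)
  have summ: "summable (\<lambda>n. inverse ((real (Suc n))\<^sup>2))"
    using inverse_power_summable[of 2, where 'a=real] by (subst summable_Suc_iff) auto
  have "(\<integral>\<^sup>+\<omega>. ennreal (Z \<omega> ^ k) \<partial>M) \<le>
      (\<integral>\<^sup>+\<omega>. 1 + (\<Sum>n. ennreal (real (n + 2) ^ k) * indicator (A n) \<omega>) \<partial>M)"
  proof (rule nn_integral_mono_AE)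
    show "AE \<omega> in M. ennreal (Z \<omega> ^ k) \<le> 1 + (\<Sum>n. ennreal (real (n + 2) ^ k) * indicator (A n) \<omega>)"
      using nonneg AE_space
    proof eventually_elim
      case (elim \<omega>)
      show ?case
      proof (cases "Z \<omega> < 1")
        case True
        then have "ennreal (Z \<omega> ^ k) \<le> ennreal 1"
          using elim by (intro ennreal_leI power_le_one) auto
        then show ?thesis by (simp add: add_increasing2)
      next
        case False
        \<comment> \<open>The index with \<open>n + 1 \<le> Z < n + 2\<close>.\<close>
        define n where "n = nat \<lfloor>Z \<omega>\<rfloor> - 1"
        have n: "real (Suc n) \<le> Z \<omega>" "Z \<omega> < real (n + 2)"
          using False unfolding n_def by linarith+
        then have "ennreal (Z \<omega> ^ k) \<le> ennreal (real (n + 2) ^ k)"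
          using elim by (intro ennreal_leI power_mono) auto
        also have "\<dots> = ennreal (real (n + 2) ^ k) * indicator (A n) \<omega>"
          using n elim by (simp add: A_def)
        also have "\<dots> \<le> (\<Sum>n. ennreal (real (n + 2) ^ k) * indicator (A n) \<omega>)"
          by (rule ennreal_le_suminf)
        finally show ?thesis by (simp add: add_increasing)
      qed
    qed
  qed
  also have "\<dots> = 1 + (\<Sum>n. ennreal (real (n + 2) ^ k) * emeasure M (A n))"
    by (subst nn_integral_add) (auto simp: emeasure_space_1 nn_integral_suminf nn_integral_cmult)
  also have "\<dots> \<le> 1 + (\<Sum>n. ennreal (2 ^ k * C * inverse ((real (Suc n))\<^sup>2)))"
  proof (intro add_left_mono suminf_le summableI)
    fix n
    have "ennreal (real (n + 2) ^ k) * emeasure M (A n) \<le> ennreal ((2 * real (Suc n)) ^ k) * ennreal (C / real (Suc n) ^ (k + 2))"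
      unfolding A_def by (intro mult_mono tail ennreal_leI power_mono) auto
    also have "\<dots> = ennreal (2 ^ k * C * inverse ((real (Suc n))\<^sup>2))"
      using \<open>0 \<le> C\<close> by (subst ennreal_mult[symmetric])
        (auto simp: power_mult_distrib power_add power2_eq_square field_simps simp del: of_nat_Suc)
    finally show "ennreal (real (n + 2) ^ k) * emeasure M (A n) \<le> ennreal (2 ^ k * C * inverse ((real (Suc n))\<^sup>2))" .
  qed
  also have "\<dots> = ennreal (1 + 2 ^ k * C * (\<Sum>n. inverse ((real (Suc n))\<^sup>2)))"
    using summ \<open>0 \<le> C\<close>
    by (subst suminf_ennreal2)
      (auto simp: suminf_mult summable_mult suminf_nonneg ennreal_plus simp del: of_nat_Suc)
  finally show ?thesis .
qed

end

section \<open>Exponential and Gamma distributions\<close>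

text \<open>
  Tilting the exponential density of parameter \<open>l\<close> by \<open>exp (k * x)\<close> gives, up to a constant, the
  one of parameter \<open>l - k\<close>.
\<close>

lemma nn_integral_exp_exponential_density:
  fixes l k :: real
  assumes "k < l" "0 < l"
  shows "(\<integral>\<^sup>+x. ennreal (exponential_density l x) * ennreal (exp (k * x)) \<partial>lborel) = ennreal (l / (l - k))"
proof -
  have "(\<integral>\<^sup>+x. ennreal (exponential_density (l - k) x) \<partial>lborel) = 1"
    using prob_space.emeasure_space_1[OF prob_space_exponential_density, of "l - k"] assms
    by (simp add: emeasure_density)
  moreover have "ennreal (exponential_density l x) * ennreal (exp (k * x)) =
      ennreal (l / (l - k)) * ennreal (exponential_density (l - k) x)" for x
  proof -
    have "exponential_density l x * exp (k * x) = l / (l - k) * exponential_density (l - k) x"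
      using assms by (simp add: exponential_density_def exp_add[symmetric]) (simp add: algebra_simps)
    then show ?thesis
      using assms by (simp add: exponential_density_nonneg flip: ennreal_mult)
  qed
  ultimately show ?thesis
    by (simp add: nn_integral_cmult)
qed

text \<open>
  The Fourier transform of an exponential law, by the fundamental theorem of calculus on \<open>(0, \<infinity>)\<close>.
\<close>

lemma complex_integral_exponential_density:
  fixes l y :: real
  assumes "0 < l"
  shows "(CLINT x|lborel. exponential_density l x *\<^sub>R iexp (y * x)) = l / (l - \<i> * y)"
proof -
  define z where "z = - complex_of_real l + \<i> * y"
  have z: "Re z = - l" and "z \<noteq> 0" using assms by (auto simp: z_def complex_eq_iff)
  define f where "f x = complex_of_real l * exp (z * of_real x)" for x :: real
  define F where "F x = (complex_of_real l / z) * exp (z * of_real x)" for x :: real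
  interpret E: prob_space "density lborel (exponential_density l)"
    by (rule prob_space_exponential_density) fact
  have cont: "isCont f x" for x unfolding f_def by (intro continuous_intros)
  have f_eq: "exponential_density l x *\<^sub>R iexp (y * x) = indicator {0..} x *\<^sub>R f x" for x
  proof -
    have "exp (z * of_real x) = exp (- x * l) *\<^sub>R iexp (y * x)"
      by (simp add: z_def scaleR_conv_of_real exp_of_real[symmetric] exp_add[symmetric] algebra_simps)
    then show ?thesis by (simp add: exponential_density_def f_def scaleR_conv_of_real indicator_def)
  qed
  have "integrable (density lborel (exponential_density l)) (\<lambda>x. iexp (y * x))"
    by (rule E.integrable_const_bound[where B = 1]) auto
  then have int0: "integrable lborel (\<lambda>x. exponential_density l x *\<^sub>R iexp (y * x))"
    using assms by (subst (asm) integrable_density) (auto simp: exponential_density_nonneg)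
  have [measurable]: "f \<in> borel_measurable borel"
    using cont by (intro borel_measurable_continuous_onI) (auto simp: continuous_at_imp_continuous_on)
  have "set_integrable lborel {0..} f"
    using int0 by (simp only: f_eq set_integrable_def)
  then have int: "set_integrable lborel (einterval 0 \<infinity>) f"
    by (rule set_integrable_subset) (auto simp: einterval_def)
  have "(LBINT x=0..\<infinity>. f x) = 0 - complex_of_real l / z"
  proof (rule interval_integral_FTC_integrable)
    show "(F has_vector_derivative f x) (at x)" for x
      unfolding F_def
      by (rule has_vector_derivative_real_field[where f = "\<lambda>w. (complex_of_real l / z) * exp (z * w)"])
        (auto intro!: derivative_eq_intros simp: f_def \<open>z \<noteq> 0\<close>)
    have "(F \<longlongrightarrow> F 0) (at_right 0)"
      unfolding F_def by (intro tendsto_intros)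
    then show "((F \<circ> real_of_ereal) \<longlongrightarrow> complex_of_real l / z) (at_right 0)"
      by (simp add: ereal_tendsto_simps zero_ereal_def F_def)
    have "(F \<longlongrightarrow> 0) at_top"
    proof (rule tendsto_norm_zero_cancel)
      have "((\<lambda>x. exp (- (l * x))) \<longlongrightarrow> 0) at_top"
        using assms by (intro filterlim_compose[OF exp_at_bot] filterlim_uminus_at_bot_at_top[THEN filterlim_compose]
            filterlim_tendsto_pos_mult_at_top[OF tendsto_const] filterlim_ident)
      then have "((\<lambda>x. (l / norm z) * exp (- (l * x))) \<longlongrightarrow> (l / norm z) * 0) at_top"
        by (intro tendsto_intros)
      then show "((\<lambda>x. norm (F x)) \<longlongrightarrow> 0) at_top"
        using assms z by (simp add: F_def norm_mult norm_divide)
    qed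
    then show "((F \<circ> real_of_ereal) \<longlongrightarrow> 0) (at_left \<infinity>)"
      by (simp add: ereal_tendsto_simps)
  qed (use cont int in auto)
  moreover have "(LBINT x=0..\<infinity>. f x) = (LBINT x:{0..}. f x)"
  proof -
    have "(LBINT x=0..\<infinity>. f x) = (LBINT x:{0<..}. f x)"
      by (simp add: interval_lebesgue_integral_0_infty)
    also have "\<dots> = (LBINT x:{0..}. f x)"
      unfolding set_lebesgue_integral_def
      by (rule integral_cong_AE) (use AE_lborel_singleton[of 0] in \<open>auto simp: indicator_def elim!: AE_mp\<close>)
    finally show ?thesis .
  qed
  moreover have "0 - complex_of_real l / z = l / (l - \<i> * y)"
  proof -
    have "complex_of_real l - \<i> * y = - z" by (simp add: z_def)
    then show ?thesis by simp
  qed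
  ultimately show ?thesis
    unfolding f_eq by (simp add: set_lebesgue_integral_def)
qed

lemma gamma_density_nonneg: "0 < r \<Longrightarrow> 0 \<le> gamma_density r x"
  by (auto simp: gamma_density_def intro!: divide_nonneg_pos Gamma_real_pos)

lemma borel_measurable_gamma_density[measurable]: "gamma_density r \<in> borel_measurable borel"
  unfolding gamma_density_def by measurable

lemma prob_space_gamma_density:
  assumes "0 < r"
  shows "prob_space (density lborel (gamma_density r))"
proof
  have "((\<lambda>x. x powr (r - 1) / exp x) has_integral Gamma r) {0..}"
    by (rule Gamma_integral_real) fact
  then have "((\<lambda>x. x powr (r - 1) / exp x / Gamma r) has_integral Gamma r / Gamma r) {0..}"
    by (rule has_integral_divide)
  then have "((\<lambda>x. if x \<in> {0..} then x powr (r - 1) / exp x / Gamma r else 0) has_integral Gamma r / Gamma r) UNIV"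
    by (subst has_integral_restrict_UNIV)
  moreover have "(if x \<in> {0..} then x powr (r - 1) / exp x / Gamma r else 0) = gamma_density r x" for x
    by (auto simp: gamma_density_def exp_minus field_simps)
  ultimately have "(gamma_density r has_integral 1) UNIV"
    using Gamma_real_pos[OF assms] by (simp add: less_imp_neq[symmetric])
  then have "(\<integral>\<^sup>+x. ennreal (gamma_density r x) \<partial>lborel) = 1"
    using nn_integral_has_integral_lborel[of "gamma_density r" 1] gamma_density_nonneg[OF assms] by auto
  then show "emeasure (density lborel (gamma_density r)) (space (density lborel (gamma_density r))) = 1"
    by (simp add: emeasure_density)
qed

text \<open>
  Up to the factor \<open>1 / Gamma r\<close>, this Fourier transform is Euler's integral
  \<open>\<integral> x powr (r + i t - 1) * exp (- x) dx\<close> for \<open>Gamma (r + i t)\<close>.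
\<close>

lemma char_ln_gamma:
  assumes "0 < r"
  shows "char (distr (density lborel (gamma_density r)) borel ln) t = Gamma (r + \<i> * t) / Gamma (complex_of_real r)"
proof -
  define z where "z = complex_of_real r + \<i> * t"
  have z: "Re z > 0" using assms by (simp add: z_def)
  let ?g = "\<lambda>x. complex_of_real x powr (z - 1) / of_real (exp x)"
  have eq: "gamma_density r x *\<^sub>R iexp (t * ln x) = (1 / Gamma r) *\<^sub>R (indicator {0<..} x *\<^sub>R ?g x)" for x
  proof (cases "0 < x")
    case True
    have "complex_of_real x powr (z - 1) = complex_of_real (x powr (r - 1)) * iexp (t * ln x)"
    proof -
      have "complex_of_real x powr (z - 1) = exp ((z - 1) * of_real (ln x))"
        using True by (simp add: powr_def Ln_of_real)
      also have "(z - 1) * of_real (ln x) = of_real ((r - 1) * ln x) + \<i> * of_real (t * ln x)"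
        by (simp add: z_def algebra_simps)
      also have "exp \<dots> = complex_of_real (x powr (r - 1)) * iexp (t * ln x)"
        using True by (simp add: exp_add exp_of_real[symmetric] powr_def)
      finally show ?thesis .
    qed
    then show ?thesis using True
      by (simp add: gamma_density_def scaleR_conv_of_real exp_minus exp_of_real field_simps)
  next
    case False
    then show ?thesis by (simp add: gamma_density_def)
  qed
  have "char (distr (density lborel (gamma_density r)) borel ln) t =
      (CLINT x|lborel. gamma_density r x *\<^sub>R iexp (t * ln x))"
    by (simp add: char_def integral_distr integral_density gamma_density_nonneg[OF assms])
  also have "\<dots> = (CLINT x|lebesgue. (1 / Gamma r) *\<^sub>R (indicator {0<..} x *\<^sub>R ?g x))"
    by (subst eq[symmetric], rule integral_completion[symmetric]) measurable
  also have "\<dots> = (1 / Gamma r) *\<^sub>R (LINT x:{0<..}|lebesgue. ?g x)"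
    by (simp only: set_lebesgue_integral_def integral_scaleR_right)
  also have "(LINT x:{0<..}|lebesgue. ?g x) = integral {0<..} ?g"
    by (rule set_lebesgue_integral_eq_integral(2)) (use absolutely_integrable_Gamma_integral'[OF z] in simp)
  also have "\<dots> = Gamma z"
    using Gamma_integral_complex'[OF z] by (rule integral_unique)
  finally show ?thesis
    by (simp add: z_def scaleR_conv_of_real Gamma_complex_of_real)
qed

text \<open>
  Passing to logarithms turns a Mellin transform into a Fourier transform, so that Levy's uniqueness
  theorem identifies the law.
\<close>

lemma distributed_exp_gamma:
  fixes L :: "'w \<Rightarrow> real"
  assumes "prob_space M" and [measurable]: "L \<in> borel_measurable M" and "0 < r"
    and char: "\<And>t. char (distr M borel L) t = Gamma (r + \<i> * t) / Gamma (complex_of_real r)"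
  shows "distributed M lborel (\<lambda>\<omega>. exp (L \<omega>)) (gamma_density r)"
proof -
  interpret prob_space M by fact
  define G where "G = density lborel (gamma_density r)"
  interpret G: prob_space G unfolding G_def by (rule prob_space_gamma_density) fact
  have [measurable_cong]: "sets G = sets borel" by (simp add: G_def)
  have "distr M borel L = distr G borel ln"
  proof (rule Levy_uniqueness)
    show "real_distribution (distr M borel L)" by (rule real_distribution_distr) simp
    show "real_distribution (distr G borel ln)" by (rule G.real_distribution_distr) simp
    show "char (distr M borel L) = char (distr G borel ln)"
      using char char_ln_gamma[OF \<open>0 < r\<close>] by (auto simp: G_def)
  qed
  then have "distr (distr M borel L) borel exp = distr (distr G borel ln) borel exp" by simp
  then have "distr M borel (\<lambda>\<omega>. exp (L \<omega>)) = distr G borel (\<lambda>x. exp (ln x))"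
    by (simp add: distr_distr comp_def)
  also have "\<dots> = distr G borel (\<lambda>x. x)"
  proof (rule distr_cong_AE)
    show "AE x in G. exp (ln x) = x"
      unfolding G_def by (subst AE_density) (auto simp: gamma_density_def)
  qed auto
  also have "\<dots> = G" by (rule distr_id2) (simp add: G_def)
  finally have "distr M lborel (\<lambda>\<omega>. exp (L \<omega>)) = density lborel (gamma_density r)"
    unfolding G_def by (metis distr_cong sets_lborel)
  then show ?thesis by (simp add: distributed_def)
qed

section \<open>The jump chain of a balanced urn\<close>

lemma nn_integral_countable_valued:
  fixes X :: "'a \<Rightarrow> 'b :: countable" and G :: "'b \<Rightarrow> ennreal"
  assumes [measurable]: "X \<in> measurable M (count_space UNIV)"
  shows "(\<integral>\<^sup>+\<omega>. G (X \<omega>) \<partial>M) =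
    (\<integral>\<^sup>+x. emeasure M {\<omega> \<in> space M. X \<omega> = x} * G x \<partial>count_space UNIV)"
proof -
  define N where "N = distr M (count_space UNIV) X"
  have em: "emeasure N {x} = emeasure M {\<omega> \<in> space M. X \<omega> = x}" for x
    by (auto simp: N_def emeasure_distr intro!: arg_cong[where f = "emeasure M"])
  have "N = density (count_space UNIV) (\<lambda>x. emeasure N {x})"
  proof (rule measure_eqI_countable)
    show "sets N = Pow UNIV" by (simp add: N_def)
    show "sets (density (count_space UNIV) (\<lambda>x. emeasure N {x})) = Pow (UNIV :: 'b set)" by simp
    show "emeasure N {x} = emeasure (density (count_space UNIV) (\<lambda>x. emeasure N {x})) {x}" for x
      by (simp add: emeasure_density)
  qed simp
  then have "(\<integral>\<^sup>+x. G x \<partial>N) = (\<integral>\<^sup>+x. G x \<partial>density (count_space UNIV) (\<lambda>x. emeasure N {x}))"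
    by (rule arg_cong[where f = "\<lambda>N. integral\<^sup>N N G"])
  also have "\<dots> = (\<integral>\<^sup>+x. emeasure N {x} * G x \<partial>count_space UNIV)"
    by (rule nn_integral_density) auto
  finally show ?thesis
    by (simp add: em) (simp add: N_def nn_integral_distr)
qed

locale balanced_urn =
  fixes m S b a c d :: int
  assumes m_S: "m + 2 \<le> S" "S \<le> 2 * m - 1"
    and b_bounds: "1 \<le> b" "b \<le> S - m - 1"
    and acd: "a = S - b" "c = S - m - b" "d = m + b"
begin

definition red :: "nat \<times> nat \<Rightarrow> nat \<times> nat" where
  "red z = (fst z + nat a, snd z + nat b)"

definition black :: "nat \<times> nat \<Rightarrow> nat \<times> nat" where
  "black z = (fst z + nat c, snd z + nat d)"

definition balls :: "nat \<times> nat \<Rightarrow> nat" where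
  "balls z = fst z + snd z"

abbreviation rate :: "nat \<times> nat \<Rightarrow> nat \<times> nat \<Rightarrow> real" where
  "rate \<equiv> urn_rate a b c d"

lemma S_pos: "0 < S" and m_pos: "0 < m" and S_less: "S < 2 * m" and m_less: "m < S"
  using m_S by linarith+

lemma entries: "0 < a" "0 < b" "0 < c" "0 < d" "a + b = S" "c + d = S" "a - c = m" "d - b = m"
  using m_S b_bounds acd by linarith+

lemma red_ne_black: "red z \<noteq> black z" and red_ne: "red z \<noteq> z" and black_ne: "black z \<noteq> z"
  using entries m_pos by (auto simp: red_def black_def prod_eq_iff)

lemma balls_red: "balls (red z) = balls z + nat S" and balls_black: "balls (black z) = balls z + nat S"
  using entries by (auto simp: red_def black_def balls_def)

lemma rate_eq: "rate z z' = (if z' = red z then real (fst z) else 0) + (if z' = black z then real (snd z) else 0)"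
proof -
  have "int (fst z') = int (fst z) + a \<and> int (snd z') = int (snd z) + b \<longleftrightarrow> z' = red z"
    using entries by (auto simp: red_def prod_eq_iff)
  moreover have "int (fst z') = int (fst z) + c \<and> int (snd z') = int (snd z) + d \<longleftrightarrow> z' = black z"
    using entries by (auto simp: black_def prod_eq_iff)
  ultimately show ?thesis by (simp add: urn_rate_def)
qed

lemma total_rate_eq: "total_rate rate z = real (balls z)"
proof -
  have "total_rate rate z = infsum (rate z) {red z, black z}"
    unfolding total_rate_def
    by (rule infsum_cong_neutral) (use red_ne[of z] black_ne[of z] in \<open>auto simp: rate_eq\<close>)
  also have "\<dots> = real (balls z)"
    using red_ne_black[of z] by (simp add: rate_eq balls_def)
  finally show ?thesis .
qed

lemma jump_prob_eq: "jump_prob rate z z' =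
    ((if z' = red z then real (fst z) else 0) + (if z' = black z then real (snd z) else 0)) / real (balls z)"
  using red_ne[of z] black_ne[of z] by (auto simp: jump_prob_def total_rate_eq rate_eq)

lemma jump_prob_nonneg: "0 \<le> jump_prob rate z z'"
  by (simp add: jump_prob_eq)

lemma jump_prob_nonzeroD: "jump_prob rate z z' \<noteq> 0 \<Longrightarrow> z' = red z \<or> z' = black z"
  by (auto simp: jump_prob_eq split: if_splits)

text \<open>
  The sum over all states reduces to the two successors of \<open>z\<close>, which are distinct because \<open>m > 0\<close>.
\<close>

lemma nn_integral_jump_prob:
  "(\<integral>\<^sup>+z'. ennreal (jump_prob rate z z') * F z' \<partial>count_space UNIV) =
    ennreal (real (fst z) / real (balls z)) * F (red z) + ennreal (real (snd z) / real (balls z)) * F (black z)"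
proof -
  have "(\<integral>\<^sup>+z'. ennreal (jump_prob rate z z') * F z' \<partial>count_space UNIV) =
      (\<Sum>z'\<in>{red z, black z}. ennreal (jump_prob rate z z') * F z')"
    by (rule nn_integral_count_space') (auto simp: jump_prob_eq)
  also have "\<dots> = ennreal (jump_prob rate z (red z)) * F (red z) + ennreal (jump_prob rate z (black z)) * F (black z)"
    using red_ne_black[of z] by simp
  finally show ?thesis
    using red_ne_black[of z] by (simp add: jump_prob_eq)
qed

lemma nn_integral_jump_prob_1:
  assumes "0 < balls z"
  shows "(\<integral>\<^sup>+z'. ennreal (jump_prob rate z z') \<partial>count_space UNIV) = 1"
  using nn_integral_jump_prob[of z "\<lambda>_. 1"] assms
  by (simp add: ennreal_plus[symmetric] add_divide_distrib[symmetric] balls_def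
      of_nat_add[symmetric] del: ennreal_plus of_nat_add)

end

text \<open>
  The jump chain and the holding times of the urn, separated from the process that they drive.
\<close>

locale urn_jump_chain = balanced_urn m S b a c d + prob_space M
  for m S b a c d :: int and M :: "'w measure" +
  fixes z0 :: "nat \<times> nat" and Y :: "nat \<Rightarrow> 'w \<Rightarrow> nat \<times> nat" and T :: "nat \<Rightarrow> 'w \<Rightarrow> real"
  assumes z0: "z0 \<noteq> (0, 0)"
    and Y_measurable[measurable]: "\<And>n. Y n \<in> measurable M (count_space UNIV)"
    and T_measurable[measurable]: "\<And>n. T n \<in> borel_measurable M"
    and jump_holding_law: "\<And>n y s. (\<And>i. i < n \<Longrightarrow> 0 \<le> s i) \<Longrightarrow>
       prob {\<omega> \<in> space M. (\<forall>i\<le>n. Y i \<omega> = y i) \<and> (\<forall>i<n. s i < T i \<omega>)} =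
       (if y 0 = z0 then 1 else 0) *
       (\<Prod>i<n. jump_prob rate (y i) (y (Suc i)) * exp (- total_rate rate (y i) * s i))"
begin

text \<open>
  The initial value of \<open>u\<^sub>1\<close>; there are \<open>S * (r + i)\<close> balls after \<open>i\<close> jumps.
\<close>

definition r :: real where "r = real (balls z0) / S"

lemma balls_z0_pos: "0 < balls z0"
  using z0 by (cases z0) (auto simp: balls_def)

lemma r_pos: "0 < r"
  using balls_z0_pos S_pos by (simp add: r_def)

definition path_prob :: "nat \<Rightarrow> (nat \<Rightarrow> nat \<times> nat) \<Rightarrow> real" where
  "path_prob k y = (if y 0 = z0 then 1 else 0) * (\<Prod>i<k. jump_prob rate (y i) (y (Suc i)))"

lemma path_prob_nonneg: "0 \<le> path_prob k y"
  by (auto simp: path_prob_def intro!: prod_nonneg jump_prob_nonneg)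

lemma balls_path:
  assumes "path_prob k y \<noteq> 0" "i \<le> k"
  shows "real (balls (y i)) = S * (r + real i)"
  using assms(2)
proof (induction i)
  case 0
  then show ?case using assms(1) S_pos by (auto simp: path_prob_def r_def split: if_splits)
next
  case (Suc i)
  then have "jump_prob rate (y i) (y (Suc i)) \<noteq> 0" using assms(1) by (auto simp: path_prob_def)
  then have "balls (y (Suc i)) = balls (y i) + nat S"
    using jump_prob_nonzeroD balls_red balls_black by metis
  with Suc S_pos show ?case by (simp add: algebra_simps)
qed

text \<open>
  The number of observed states may be smaller than the number of observed holding times.  All paths
  of positive probability have the same total rates, so summing the joint law over the last state
  replaces a transition probability by \<open>1\<close> and leaves the exponential factors unchanged.
  This is how balance makes the holding times independent of the colours.
\<close>

lemma path_law:
  fixes k n :: nat and s :: "nat \<Rightarrow> real"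
  assumes "k \<le> n" and s: "\<And>i. i < n \<Longrightarrow> 0 \<le> s i"
  shows "emeasure M {\<omega> \<in> space M. (\<forall>i\<le>k. Y i \<omega> = y i) \<and> (\<forall>i<n. s i < T i \<omega>)} =
    ennreal (path_prob k y * (\<Prod>i<n. exp (- (S * (r + real i) * s i))))"
  using assms(1)
proof (induction k arbitrary: y rule: inc_induct)
  case base
  have "prob {\<omega> \<in> space M. (\<forall>i\<le>n. Y i \<omega> = y i) \<and> (\<forall>i<n. s i < T i \<omega>)} =
      path_prob n y * (\<Prod>i<n. exp (- (real (balls (y i)) * s i)))"
    using s by (subst jump_holding_law) (auto simp: total_rate_eq path_prob_def prod.distrib)
  also have "\<dots> = path_prob n y * (\<Prod>i<n. exp (- (S * (r + real i) * s i)))"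
  proof (cases "path_prob n y = 0")
    case False
    then have "real (balls (y i)) = S * (r + real i)" if "i < n" for i
      using balls_path that by auto
    then show ?thesis by simp
  qed simp
  finally show ?case by (simp add: emeasure_eq_measure)
next
  case (step k)
  define A where "A z = {\<omega> \<in> space M. (\<forall>i\<le>Suc k. Y i \<omega> = (y(Suc k := z)) i) \<and> (\<forall>i<n. s i < T i \<omega>)}" for z
  define e where "e = (\<Prod>i<n. exp (- (S * (r + real i) * s i)))"
  have e: "0 \<le> e" by (auto simp: e_def intro: prod_nonneg)
  have "{\<omega> \<in> space M. (\<forall>i\<le>k. Y i \<omega> = y i) \<and> (\<forall>i<n. s i < T i \<omega>)} = (\<Union>z. A z)"
    by (auto simp: A_def le_Suc_eq)
  moreover have "emeasure M (\<Union>z. A z) = (\<integral>\<^sup>+z. emeasure M (A z) \<partial>count_space UNIV)"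
  proof (rule emeasure_UN_countable)
    show "A z \<in> sets M" for z unfolding A_def by measurable
    show "disjoint_family_on A UNIV"
      by (auto simp: disjoint_family_on_def A_def dest!: spec[of _ "Suc k"])
  qed auto
  moreover have "emeasure M (A z) = ennreal (path_prob k y * e) * ennreal (jump_prob rate (y k) z)" for z
    unfolding A_def step.IH e_def[symmetric] using e path_prob_nonneg[of k y] jump_prob_nonneg
    by (auto simp: path_prob_def prod_nonneg jump_prob_nonneg mult_ac simp flip: ennreal_mult)
  moreover have "ennreal (path_prob k y * e) * (\<integral>\<^sup>+z. ennreal (jump_prob rate (y k) z) \<partial>count_space UNIV) =
      ennreal (path_prob k y * e)"
  \<comment> \<open>On a path of positive probability the urn is not empty, so the transition probabilities sum to \<open>1\<close>.\<close>
  proof (cases "path_prob k y = 0")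
    case False
    then have "0 < real (balls (y k))" using balls_path[of k y k] r_pos S_pos by simp
    then show ?thesis by (subst nn_integral_jump_prob_1) auto
  qed simp
  ultimately show ?case by (simp add: nn_integral_cmult e_def)
qed

lemma AE_of_emeasure_1:
  assumes "emeasure M {\<omega> \<in> space M. P \<omega>} = 1"
  shows "AE \<omega> in M. P \<omega>"
proof -
  have "prob {\<omega> \<in> space M. P \<omega>} = 1" using assms by (simp add: measure_def)
  from AE_prob_1[OF this] show ?thesis by eventually_elim simp
qed

lemma AE_Y0: "AE \<omega> in M. Y 0 \<omega> = z0"
proof -
  have "emeasure M {\<omega> \<in> space M. Y 0 \<omega> = z0} = 1"
    using path_law[of 0 0 "\<lambda>_. 0" "\<lambda>_. z0"] by (simp add: path_prob_def)
  then show ?thesis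
    by (rule AE_of_emeasure_1)
qed

lemma AE_T_pos: "AE \<omega> in M. \<forall>i. 0 < T i \<omega>"
proof -
  have "AE \<omega> in M. \<forall>i<n. 0 < T i \<omega>" for n
  proof -
    have "emeasure M {\<omega> \<in> space M. Y 0 \<omega> = z0 \<and> (\<forall>i<n. 0 < T i \<omega>)} = 1"
      using path_law[of 0 n "\<lambda>_. 0" "\<lambda>_. z0"] by (simp add: path_prob_def)
    from AE_of_emeasure_1[OF this] show ?thesis by eventually_elim simp
  qed
  then have "AE \<omega> in M. \<forall>n. \<forall>i<n. 0 < T i \<omega>" by (simp add: AE_all_countable)
  then show ?thesis by eventually_elim blast
qed

text \<open>
  The maximum accounts for negative thresholds, which positive holding times always exceed.
\<close>

lemma T_joint_tail:
  fixes n :: nat and s :: "nat \<Rightarrow> real"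
  shows "prob {\<omega> \<in> space M. \<forall>i<n. s i < T i \<omega>} = (\<Prod>i<n. exp (- (S * (r + real i) * max 0 (s i))))"
proof -
  have "emeasure M {\<omega> \<in> space M. \<forall>i<n. s i < T i \<omega>} =
      emeasure M {\<omega> \<in> space M. (\<forall>i\<le>0. Y i \<omega> = z0) \<and> (\<forall>i<n. max 0 (s i) < T i \<omega>)}"
    by (rule emeasure_eq_AE) (use AE_T_pos AE_Y0 in \<open>auto elim!: AE_mp\<close>)
  also have "\<dots> = ennreal (\<Prod>i<n. exp (- (S * (r + real i) * max 0 (s i))))"
    by (subst path_law) (auto simp: path_prob_def)
  finally show ?thesis by (simp add: measure_def prod_nonneg)
qed

lemma T_tail: "prob {\<omega> \<in> space M. s < T i \<omega>} = exp (- (S * (r + real i) * max 0 s))"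
proof -
  have "prob {\<omega> \<in> space M. s < T i \<omega>} =
      prob {\<omega> \<in> space M. \<forall>j<Suc i. (if j = i then s else 0) < T j \<omega>}"
    unfolding measure_def
    by (intro arg_cong[where f = enn2real] emeasure_eq_AE)
      (use AE_T_pos in \<open>auto elim!: AE_mp simp: less_Suc_eq\<close>)
  also have "\<dots> = exp (- (S * (r + real i) * max 0 s))"
    unfolding T_joint_tail by simp
  finally show ?thesis .
qed

lemma T_exponential: "distributed M lborel (T i) (exponential_density (S * (r + real i)))"
proof -
  have pos: "0 < S * (r + real i)" using S_pos r_pos by simp
  have "prob {\<omega> \<in> space M. T i \<omega> \<le> s} = 1 - exp (- s * (S * (r + real i)))" if "0 \<le> s" for s
  proof -
    have "prob {\<omega> \<in> space M. T i \<omega> \<le> s} = 1 - prob {\<omega> \<in> space M. s < T i \<omega>}"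
      by (subst prob_compl[symmetric]) (auto intro!: arg_cong[where f = prob])
    then show ?thesis using that by (simp add: T_tail mult_ac)
  qed
  then show ?thesis using pos by (simp add: exponential_distributed_iff)
qed

lemma greaterThan_Int_greaterThan: "{x<..} \<inter> {y<..} = {max x y<..}" for x y :: real
  by auto

text \<open>
  The half-lines, together with the whole line, are stable under intersection and generate the Borel
  sets; on them independence is the product formula for joint tails.
\<close>

lemma T_indep: "indep_vars (\<lambda>_. borel) T {..<n}"
proof -
  define E :: "real set set" where "E = insert UNIV (range greaterThan)"
  have "indep_vars (\<lambda>_. borel) T {..<Suc n}"
  proof (subst indep_vars_finite[where E = "\<lambda>_. E"])
    have "sets (borel :: real measure) = sigma_sets UNIV (range greaterThan)"
      by (subst borel_Ioi) simp
    also have "\<dots> = sigma_sets UNIV E"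
      by (rule sigma_sets_eqI) (auto simp: E_def intro: sigma_sets_top)
    finally show "sets (borel :: real measure) = sigma_sets (space borel) E" by simp
    show "Int_stable E"
      by (auto simp: E_def Int_stable_def greaterThan_Int_greaterThan)
    show "\<forall>A\<in>{..<Suc n} \<rightarrow> E. prob (\<Inter>j\<in>{..<Suc n}. T j -` A j \<inter> space M) =
        (\<Prod>j\<in>{..<Suc n}. prob (T j -` A j \<inter> space M))"
    proof
      fix A assume A: "A \<in> {..<Suc n} \<rightarrow> E"
      have "\<exists>s. AE \<omega> in M. T j \<omega> \<in> A j \<longleftrightarrow> s < T j \<omega>" if "j < Suc n" for j
      proof (cases "A j = UNIV")
        case True
        then show ?thesis using AE_T_pos by (intro exI[of _ 0]) auto
      next
        case False
        moreover have "A j \<in> E" using A that by auto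
        ultimately obtain s where "A j = {s<..}" by (auto simp: E_def)
        then show ?thesis by (intro exI[of _ s]) simp
      qed
      then obtain s where s: "\<And>j. j < Suc n \<Longrightarrow> AE \<omega> in M. T j \<omega> \<in> A j \<longleftrightarrow> s j < T j \<omega>"
        by metis
      have Am: "A j \<in> sets borel" if "j < Suc n" for j
      proof -
        have "A j \<in> E" using A that by auto
        moreover have "E \<subseteq> sets borel" by (auto simp: E_def)
        ultimately show ?thesis by blast
      qed
      have "prob (\<Inter>j\<in>{..<Suc n}. T j -` A j \<inter> space M) = prob {\<omega> \<in> space M. \<forall>j<Suc n. s j < T j \<omega>}"
        unfolding measure_def
      proof (intro arg_cong[where f = enn2real] emeasure_eq_AE)
        have "AE \<omega> in M. \<forall>j\<in>{..<Suc n}. T j \<omega> \<in> A j \<longleftrightarrow> s j < T j \<omega>"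
          using s by (intro AE_finite_allI) auto
        then show "AE \<omega> in M. \<omega> \<in> (\<Inter>j\<in>{..<Suc n}. T j -` A j \<inter> space M) \<longleftrightarrow>
            \<omega> \<in> {\<omega> \<in> space M. \<forall>j<Suc n. s j < T j \<omega>}"
          by eventually_elim auto
        show "(\<Inter>j\<in>{..<Suc n}. T j -` A j \<inter> space M) \<in> sets M"
          using Am by (intro sets.finite_INT measurable_sets[OF T_measurable]) auto
      qed auto
      also have "\<dots> = (\<Prod>j\<in>{..<Suc n}. prob {\<omega> \<in> space M. s j < T j \<omega>})"
        by (simp only: T_joint_tail T_tail)
      also have "\<dots> = (\<Prod>j\<in>{..<Suc n}. prob (T j -` A j \<inter> space M))"
      proof (rule prod.cong)
        fix j assume j: "j \<in> {..<Suc n}"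
        show "prob {\<omega> \<in> space M. s j < T j \<omega>} = prob (T j -` A j \<inter> space M)"
          unfolding measure_def
          by (intro arg_cong[where f = enn2real] emeasure_eq_AE)
            (use s[of j] j Am[of j] measurable_sets[OF T_measurable, of "A j" j] in auto)
      qed simp
      finally show "prob (\<Inter>j\<in>{..<Suc n}. T j -` A j \<inter> space M) =
          (\<Prod>j\<in>{..<Suc n}. prob (T j -` A j \<inter> space M))" .
    qed
  qed (auto simp: E_def)
  then show ?thesis by (rule indep_vars_subset) auto
qed

text \<open>
  A list, because lists of states form a countable type, on which expectations are sums.
\<close>

definition history :: "nat \<Rightarrow> 'w \<Rightarrow> (nat \<times> nat) list" where
  "history n \<omega> = map (\<lambda>i. Y i \<omega>) [0..<Suc n]"

lemma history_eq_iff: "history n \<omega> = v \<longleftrightarrow> length v = Suc n \<and> (\<forall>i\<le>n. Y i \<omega> = v ! i)"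
  by (auto simp: history_def list_eq_iff_nth_eq less_Suc_eq_le simp del: upt_Suc)

lemma history_nth: "j \<le> n \<Longrightarrow> history n \<omega> ! j = Y j \<omega>"
  by (simp add: history_def del: upt_Suc)

lemma measurable_history[measurable]: "history n \<in> measurable M (count_space UNIV)"
proof (rule measurable_count_space_eq2_countable[THEN iffD2], safe)
  fix v
  have "history n -` {v} \<inter> space M = {\<omega> \<in> space M. length v = Suc n \<and> (\<forall>i\<le>n. Y i \<omega> = v ! i)}"
    using history_eq_iff[of n _ v] by auto
  then show "history n -` {v} \<inter> space M \<in> sets M" by simp
qed auto

lemma history_law:
  assumes "length v = Suc n"
  shows "emeasure M {\<omega> \<in> space M. history n \<omega> = v} = ennreal (path_prob n (\<lambda>i. v ! i))"
proof -
  have "emeasure M {\<omega> \<in> space M. history n \<omega> = v} =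
      emeasure M {\<omega> \<in> space M. (\<forall>i\<le>n. Y i \<omega> = v ! i) \<and> (\<forall>i<n. 0 < T i \<omega>)}"
    by (rule emeasure_eq_AE) (use AE_T_pos assms in \<open>auto elim!: AE_mp simp: history_eq_iff\<close>)
  then show ?thesis by (subst (asm) path_law) auto
qed

text \<open>
  Conditioning on the past: in an expectation, \<open>Y (Suc n)\<close> may be averaged with the transition
  probabilities out of \<open>Y n\<close>.
\<close>

lemma markov_property:
  fixes F :: "(nat \<times> nat) list \<Rightarrow> nat \<times> nat \<Rightarrow> ennreal"
  shows "(\<integral>\<^sup>+\<omega>. F (history n \<omega>) (Y (Suc n) \<omega>) \<partial>M) =
    (\<integral>\<^sup>+\<omega>. ennreal (real (fst (Y n \<omega>)) / real (balls (Y n \<omega>))) * F (history n \<omega>) (red (Y n \<omega>)) +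
           ennreal (real (snd (Y n \<omega>)) / real (balls (Y n \<omega>))) * F (history n \<omega>) (black (Y n \<omega>)) \<partial>M)"
proof -
  have law: "emeasure M {\<omega> \<in> space M. (history n \<omega>, Y (Suc n) \<omega>) = (v, z)} =
      emeasure M {\<omega> \<in> space M. history n \<omega> = v} * ennreal (jump_prob rate (v ! n) z)" for v z
  proof (cases "length v = Suc n")
    case True
    have "{\<omega> \<in> space M. (history n \<omega>, Y (Suc n) \<omega>) = (v, z)} = {\<omega> \<in> space M. history (Suc n) \<omega> = v @ [z]}"
      by (auto simp: history_def)
    moreover have "path_prob (Suc n) (\<lambda>i. (v @ [z]) ! i) = path_prob n (\<lambda>i. v ! i) * jump_prob rate (v ! n) z"
      using True by (auto simp: path_prob_def nth_append)
    ultimately show ?thesis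
      using True path_prob_nonneg jump_prob_nonneg
      by (simp add: history_law ennreal_mult)
  next
    case False
    then show ?thesis by (simp add: history_eq_iff)
  qed
  have pair: "(\<lambda>\<omega>. (history n \<omega>, Y (Suc n) \<omega>)) \<in> measurable M (count_space UNIV)"
  proof (rule measurable_count_space_eq2_countable[THEN iffD2], safe)
    fix v z
    have "(\<lambda>\<omega>. (history n \<omega>, Y (Suc n) \<omega>)) -` {(v, z)} \<inter> space M =
        {\<omega> \<in> space M. history n \<omega> = v \<and> Y (Suc n) \<omega> = z}" by auto
    then show "(\<lambda>\<omega>. (history n \<omega>, Y (Suc n) \<omega>)) -` {(v, z)} \<inter> space M \<in> sets M" by simp
  qed auto
  have "(\<integral>\<^sup>+\<omega>. F (history n \<omega>) (Y (Suc n) \<omega>) \<partial>M) =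
      (\<integral>\<^sup>+\<omega>. case_prod F (history n \<omega>, Y (Suc n) \<omega>) \<partial>M)" by simp
  also have "\<dots> = (\<integral>\<^sup>+p. emeasure M {\<omega> \<in> space M. (history n \<omega>, Y (Suc n) \<omega>) = p} * case_prod F p \<partial>count_space UNIV)"
    by (rule nn_integral_countable_valued) (rule pair)
  also have "\<dots> = (\<integral>\<^sup>+v. \<integral>\<^sup>+z. emeasure M {\<omega> \<in> space M. (history n \<omega>, Y (Suc n) \<omega>) = (v, z)} * F v z
      \<partial>count_space UNIV \<partial>count_space UNIV)"
    by (subst nn_integral_fst_count_space[symmetric]) simp
  also have "\<dots> = (\<integral>\<^sup>+v. emeasure M {\<omega> \<in> space M. history n \<omega> = v} *
      (\<integral>\<^sup>+z. ennreal (jump_prob rate (v ! n) z) * F v z \<partial>count_space UNIV) \<partial>count_space UNIV)"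
    by (simp only: law mult.assoc) (simp add: nn_integral_cmult)
  also have "\<dots> = (\<integral>\<^sup>+\<omega>. (\<integral>\<^sup>+z. ennreal (jump_prob rate (history n \<omega> ! n) z) * F (history n \<omega>) z \<partial>count_space UNIV) \<partial>M)"
    by (rule nn_integral_countable_valued[symmetric]) simp
  finally show ?thesis by (simp add: nn_integral_jump_prob history_nth)
qed

lemma AE_balls_Y: "AE \<omega> in M. \<forall>n. real (balls (Y n \<omega>)) = S * (r + real n)"
proof -
  have "AE \<omega> in M. real (balls (Y n \<omega>)) = S * (r + real n)" for n
  proof (induction n)
    case 0
    show ?case using AE_Y0 by eventually_elim (use S_pos in \<open>simp add: r_def\<close>)
  next
    case (Suc n)
    let ?f = "\<lambda>z. indicator {z. real (balls z) \<noteq> S * (r + real (Suc n))} z :: ennreal"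
    have "(\<integral>\<^sup>+\<omega>. ?f (Y (Suc n) \<omega>) \<partial>M) = (\<integral>\<^sup>+\<omega>. 0 \<partial>M)"
      by (subst markov_property[of "\<lambda>_. ?f"], rule nn_integral_cong_AE, use Suc in eventually_elim)
        (use S_pos in \<open>simp add: balls_red balls_black algebra_simps\<close>)
    then have "AE \<omega> in M. ?f (Y (Suc n) \<omega>) = 0"
      by (intro nn_integral_0_iff_AE[THEN iffD1]) auto
    then show ?case by eventually_elim (auto simp: indicator_def split: if_splits)
  qed
  then show ?thesis by (simp add: AE_all_countable)
qed

end

section \<open>Jump times\<close>

text \<open>
  The left-hand side is \<open>E (exp (l * (X - ln (1 + 1 / \<rho>))))\<close> for an exponential variable \<open>X\<close> of
  parameter \<open>\<rho>\<close>.  The centring differs from the mean \<open>1 / \<rho>\<close> only by a term of order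
  \<open>1 / \<rho>\<^sup>2\<close>, which is responsible for the summand \<open>\<bar>l\<bar>\<close>; in exchange the
  centrings telescope when \<open>\<rho>\<close> runs through \<open>r, r + 1, \<dots>\<close>.
\<close>

lemma centred_exponential_mgf_le:
  fixes \<rho> l :: real
  assumes "0 < \<rho>" "\<bar>l\<bar> \<le> \<rho> / 2"
  shows "\<rho> / (\<rho> - l) * exp (- (l * ln (1 + 1 / \<rho>))) \<le> exp ((2 * l\<^sup>2 + \<bar>l\<bar>) / \<rho>\<^sup>2)"
proof -
  define x where "x = l / \<rho>"
  have x: "\<bar>x\<bar> \<le> 1 / 2" using assms by (simp add: x_def field_simps)
  have "\<bar>ln (1 + (- x)) - (- x)\<bar> \<le> 2 * (- x)\<^sup>2"
    using x by (intro abs_ln_one_plus_x_minus_x_bound) simp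
  then have 1: "- ln (1 - x) \<le> x + 2 * x\<^sup>2" by simp
  have 2: "0 \<le> 1 / \<rho> - ln (1 + 1 / \<rho>)" "1 / \<rho> - ln (1 + 1 / \<rho>) \<le> 1 / \<rho>\<^sup>2"
  proof -
    show "0 \<le> 1 / \<rho> - ln (1 + 1 / \<rho>)"
      using ln_add_one_self_le_self[of "1 / \<rho>"] assms by simp
    have "- ln (1 + 1 / \<rho>) = ln (1 + (- 1 / (\<rho> + 1)))"
      using assms by (subst ln_inverse[symmetric]) (auto simp: field_simps add_pos_pos)
    also have "\<dots> \<le> - 1 / (\<rho> + 1)"
      using assms by (intro ln_add_one_self_le_self2) (auto simp: field_simps)
    finally have "1 / \<rho> - ln (1 + 1 / \<rho>) \<le> 1 / \<rho> - 1 / (\<rho> + 1)" by simp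
    also have "\<dots> = 1 / (\<rho> * (\<rho> + 1))" using assms by (simp add: field_simps)
    also have "\<dots> \<le> 1 / \<rho>\<^sup>2"
      using assms by (intro divide_left_mono) (auto simp: power2_eq_square)
    finally show "1 / \<rho> - ln (1 + 1 / \<rho>) \<le> 1 / \<rho>\<^sup>2" .
  qed
  have "- (l * ln (1 + 1 / \<rho>)) = - x + l * (1 / \<rho> - ln (1 + 1 / \<rho>))"
    by (simp add: x_def algebra_simps)
  also have "l * (1 / \<rho> - ln (1 + 1 / \<rho>)) \<le> \<bar>l\<bar> * (1 / \<rho>\<^sup>2)"
    using 2 by (intro order_trans[OF mult_right_mono[of l "\<bar>l\<bar>"] mult_left_mono]) auto
  finally have 3: "- (l * ln (1 + 1 / \<rho>)) \<le> - x + \<bar>l\<bar> / \<rho>\<^sup>2" by simp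
  have "\<rho> / (\<rho> - l) = exp (- ln (1 - x))"
    using x assms by (simp add: exp_minus) (simp add: x_def field_simps)
  then have "\<rho> / (\<rho> - l) * exp (- (l * ln (1 + 1 / \<rho>))) = exp (- ln (1 - x) + - (l * ln (1 + 1 / \<rho>)))"
    by (simp only: exp_add)
  also have "\<dots> \<le> exp ((x + 2 * x\<^sup>2) + (- x + \<bar>l\<bar> / \<rho>\<^sup>2))"
    using 1 3 by (simp only: exp_le_cancel_iff)
  also have "(x + 2 * x\<^sup>2) + (- x + \<bar>l\<bar> / \<rho>\<^sup>2) = (2 * l\<^sup>2 + \<bar>l\<bar>) / \<rho>\<^sup>2"
    by (simp add: x_def power_divide add_divide_distrib)
  finally show ?thesis .
qed

lemma summable_powr_Suc:
  fixes s :: real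
  assumes "s < - 1"
  shows "summable (\<lambda>n. real (Suc n) powr s)"
  using assms summable_real_powr_iff[of s] by (subst summable_Suc_iff) simp

context urn_jump_chain
begin

definition jump_time :: "nat \<Rightarrow> 'w \<Rightarrow> real" where
  "jump_time n \<omega> = (\<Sum>i<n. T i \<omega>)"

lemma jump_time_measurable[measurable]: "jump_time n \<in> borel_measurable M"
  unfolding jump_time_def by measurable

lemma T_mgf:
  fixes l :: real
  assumes "l < r + real i"
  shows "(\<integral>\<^sup>+\<omega>. ennreal (exp (l * (S * T i \<omega>))) \<partial>M) = ennreal ((r + real i) / (r + real i - l))"
proof -
  have pos: "0 < r + real i" "0 < real_of_int S" using r_pos S_pos by auto
  have "(\<integral>\<^sup>+\<omega>. ennreal (exp ((l * S) * T i \<omega>)) \<partial>M) =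
      (\<integral>\<^sup>+x. ennreal (exponential_density (S * (r + real i)) x) * ennreal (exp ((l * S) * x)) \<partial>lborel)"
    by (rule distributed_nn_integral[OF T_exponential, symmetric]) simp
  also have "\<dots> = ennreal ((S * (r + real i)) / (S * (r + real i) - l * S))"
    using pos assms by (intro nn_integral_exp_exponential_density) (simp_all add: mult.commute)
  also have "(S * (r + real i)) / (S * (r + real i) - l * S) = (r + real i) / (r + real i - l)"
  proof -
    have "S * (r + real i) - l * S = S * (r + real i - l)" by (simp add: algebra_simps)
    then show ?thesis using pos by simp
  qed
  finally show ?thesis by (simp add: mult_ac)
qed

text \<open>
  The exponential moments of sums of holding times, centred by arbitrary constants \<open>e i\<close>.
\<close>

lemma T_sum_mgf:
  fixes l :: real and e :: "nat \<Rightarrow> real"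
  assumes "finite I" and l: "\<And>i. i \<in> I \<Longrightarrow> l < r + real i"
  shows "(\<integral>\<^sup>+\<omega>. ennreal (exp (l * (\<Sum>i\<in>I. S * T i \<omega> - e i))) \<partial>M) =
    ennreal (\<Prod>i\<in>I. (r + real i) / (r + real i - l) * exp (- (l * e i)))"
proof -
  obtain n where "I \<subseteq> {..<n}" using \<open>finite I\<close> by (metis finite_nat_iff_bounded)
  then have ind: "indep_vars (\<lambda>_. borel) T I" by (rule indep_vars_subset[OF T_indep])
  have "indep_vars (\<lambda>_. borel) (\<lambda>i \<omega>. ennreal (exp (l * (S * T i \<omega> - e i)))) I"
    by (rule indep_vars_compose2[OF ind]) simp
  then have "(\<integral>\<^sup>+\<omega>. (\<Prod>i\<in>I. ennreal (exp (l * (S * T i \<omega> - e i)))) \<partial>M) =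
      (\<Prod>i\<in>I. \<integral>\<^sup>+\<omega>. ennreal (exp (l * (S * T i \<omega> - e i))) \<partial>M)"
    using \<open>finite I\<close> by (intro indep_vars_nn_integral) auto
  moreover have "(\<integral>\<^sup>+\<omega>. ennreal (exp (l * (S * T i \<omega> - e i))) \<partial>M) =
      ennreal ((r + real i) / (r + real i - l) * exp (- (l * e i)))" if "i \<in> I" for i
  proof -
    have "(\<integral>\<^sup>+\<omega>. ennreal (exp (l * (S * T i \<omega> - e i))) \<partial>M) =
        (\<integral>\<^sup>+\<omega>. ennreal (exp (- (l * e i))) * ennreal (exp (l * (S * T i \<omega>))) \<partial>M)"
      by (simp add: exp_add[symmetric] algebra_simps flip: ennreal_mult)
    also have "\<dots> = ennreal (exp (- (l * e i))) * ennreal ((r + real i) / (r + real i - l))"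
      by (simp add: nn_integral_cmult T_mgf l[OF that])
    finally show ?thesis
      using l[OF that] r_pos by (simp add: mult.commute flip: ennreal_mult)
  qed
  moreover have "(\<Prod>i\<in>I. ennreal (exp (l * (S * T i \<omega> - e i)))) = ennreal (exp (l * (\<Sum>i\<in>I. S * T i \<omega> - e i)))" for \<omega>
    using \<open>finite I\<close> by (simp add: prod_ennreal sum_distrib_left exp_sum)
  ultimately show ?thesis
    using l r_pos by (simp add: prod_ennreal less_imp_le)
qed

text \<open>
  The increments of \<open>S * jump_time n - ln ((r + n) / r)\<close> are \<open>S * T i - ln (1 + 1 / (r + i))\<close>, with
  exponential moments \<open>exp (O(l\<^sup>2 / i\<^sup>2))\<close>.  They may thus be tested with \<open>l\<close> as large as
  \<open>\<kappa> * j powr (1 / 4)\<close> for \<open>i \<ge> j\<close>, the product of the moments staying bounded since the sum of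
  \<open>i powr (1 / 2 - 2)\<close> is finite.
\<close>

lemma jump_time_converges:
  obtains L where "L \<in> borel_measurable M"
    and "AE \<omega> in M. (\<lambda>n. ln (r + real n) - S * jump_time n \<omega>) \<longlonglongrightarrow> L \<omega>"
proof -
  define e where "e i = ln (1 + 1 / (r + real i))" for i
  define X where "X n \<omega> = (\<Sum>i<n. S * T i \<omega> - e i)" for n \<omega>
  have [measurable]: "X n \<in> borel_measurable M" for n by (simp add: X_def[abs_def])
  have X_eq: "X n \<omega> = S * jump_time n \<omega> - ln (r + real n) + ln r" for n \<omega>
  proof (induction n)
    case 0
    then show ?case by (simp add: X_def jump_time_def)
  next
    case (Suc n)
    have pos: "0 < r + real n" using r_pos by simp
    then have "1 + 1 / (r + real n) = (r + real (Suc n)) / (r + real n)"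
      by (simp add: field_simps)
    then have "e n = ln (r + real (Suc n)) - ln (r + real n)"
      using pos by (simp add: e_def ln_div)
    then show ?case using Suc by (simp add: X_def jump_time_def algebra_simps)
  qed
  \<comment> \<open>Small enough for \<open>\<bar>l\<bar> \<le> (r + i) / 2\<close> also at \<open>i = 0\<close>, where \<open>r\<close> may be below \<open>1\<close>.\<close>
  define \<kappa> where "\<kappa> = min r 1 / 2"
  have \<kappa>: "0 < \<kappa>" "\<kappa> \<le> 1 / 2" "2 * \<kappa> \<le> r" using r_pos by (auto simp: \<kappa>_def)
  define p where "p i = real (Suc i) powr (- 3 / 2)" for i
  define C where "C = exp (1 / (2 * \<kappa>\<^sup>2) * (\<Sum>i. p i))"
  have p: "0 \<le> p i" for i by (simp add: p_def)
  have summ: "summable p" unfolding p_def by (rule summable_powr_Suc) simp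
  have step: "(r + real i) / (r + real i - l) * exp (- (l * e i)) \<le> exp (1 / (2 * \<kappa>\<^sup>2) * p i)"
    and step_less: "l < r + real i"
    if l: "l = s * (\<kappa> * real (Suc j) powr (1 / 4))" and s: "s \<in> {-1, 1}" and ij: "j \<le> i" for i j s l
  proof -
    define w where "w = real (Suc i)"
    have w: "1 \<le> w" by (simp add: w_def)
    have rho: "2 * \<kappa> * w \<le> r + real i"
    proof -
      have "2 * \<kappa> * w = 2 * \<kappa> + 2 * \<kappa> * real i" by (simp add: w_def algebra_simps)
      also have "\<dots> \<le> r + 1 * real i"
        using \<kappa> by (intro add_mono mult_right_mono) auto
      finally show ?thesis by simp
    qed
    have l1: "\<bar>l\<bar> \<le> \<kappa> * w powr (1 / 4)"
      using s ij \<kappa> by (auto simp: l abs_mult w_def intro!: mult_left_mono powr_mono2)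
    also have "\<dots> \<le> \<kappa> * w powr 1"
      using w \<kappa> by (intro mult_left_mono powr_mono) auto
    also have "\<dots> = \<kappa> * w" using w by simp
    finally have l2: "\<bar>l\<bar> \<le> (r + real i) / 2" using rho by (simp add: mult.assoc)
    have "0 < r + real i" using r_pos by simp
    moreover have "l \<le> (r + real i) / 2" using l2 by (rule abs_le_D1)
    ultimately show "l < r + real i" by simp
    have "(r + real i) / (r + real i - l) * exp (- (l * e i)) \<le> exp ((2 * l\<^sup>2 + \<bar>l\<bar>) / (r + real i)\<^sup>2)"
      unfolding e_def using r_pos l2 by (intro centred_exponential_mgf_le) auto
    also have "\<dots> \<le> exp ((2 * w powr (1 / 2)) / (2 * \<kappa> * w)\<^sup>2)"
    proof -
      have "l\<^sup>2 = \<bar>l\<bar>\<^sup>2" by simp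
      also have "\<dots> \<le> (\<kappa> * w powr (1 / 4))\<^sup>2" by (intro power_mono l1) auto
      also have "\<dots> = \<kappa>\<^sup>2 * w powr (1 / 2)"
        by (simp add: power_mult_distrib power2_eq_square powr_add[symmetric])
      also have "\<dots> \<le> (1 / 2)\<^sup>2 * w powr (1 / 2)"
        using \<kappa> by (intro mult_right_mono power_mono) auto
      finally have "4 * l\<^sup>2 \<le> w powr (1 / 2)" by (simp add: power2_eq_square)
      then have a1: "2 * l\<^sup>2 \<le> w powr (1 / 2)"
        using zero_le_power2[of l] by linarith
      have "\<bar>l\<bar> \<le> 1 * w powr (1 / 2)"
        using l1 \<kappa> w by (intro order_trans[OF l1] mult_mono powr_mono) auto
      then have "2 * l\<^sup>2 + \<bar>l\<bar> \<le> 2 * w powr (1 / 2)" using a1 by linarith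
      moreover have "(2 * \<kappa> * w)\<^sup>2 \<le> (r + real i)\<^sup>2"
        using rho \<kappa> w by (intro power_mono) auto
      ultimately have "(2 * l\<^sup>2 + \<bar>l\<bar>) / (r + real i)\<^sup>2 \<le> (2 * w powr (1 / 2)) / (2 * \<kappa> * w)\<^sup>2"
        using \<kappa> w by (intro frac_le) auto
      then show ?thesis by simp
    qed
    also have "(2 * w powr (1 / 2)) / (2 * \<kappa> * w)\<^sup>2 = 1 / (2 * \<kappa>\<^sup>2) * p i"
    proof -
      have "w powr (1 / 2) / w\<^sup>2 = w powr (1 / 2) / w powr 2"
        using w by simp
      also have "\<dots> = w powr (1 / 2 - 2)" by (rule powr_diff[symmetric])
      also have "\<dots> = p i" by (simp add: p_def w_def)
      finally have "p i = w powr (1 / 2) / w\<^sup>2" ..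
      then show ?thesis by (simp add: power_mult_distrib field_simps)
    qed
    finally show "(r + real i) / (r + real i - l) * exp (- (l * e i)) \<le> exp (1 / (2 * \<kappa>\<^sup>2) * p i)" .
  qed
  have bound: "(\<integral>\<^sup>+\<omega>. ennreal (exp (s * (\<kappa> * real (Suc j) powr (1 / 4)) * (X n \<omega> - X j \<omega>))) \<partial>M) \<le> ennreal C"
    if "j \<le> n" "s \<in> {-1, 1}" for s j n
  proof -
    define l where "l = s * (\<kappa> * real (Suc j) powr (1 / 4))"
    have eq: "X n \<omega> - X j \<omega> = (\<Sum>i\<in>{j..<n}. S * T i \<omega> - e i)" for \<omega>
      unfolding X_def by (rule sum_diff_nat_ivl[of 0 j n, folded lessThan_atLeast0, OF _ \<open>j \<le> n\<close>]) simp
    have "(\<integral>\<^sup>+\<omega>. ennreal (exp (l * (X n \<omega> - X j \<omega>))) \<partial>M) =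
        ennreal (\<Prod>i\<in>{j..<n}. (r + real i) / (r + real i - l) * exp (- (l * e i)))"
      unfolding eq using step_less[OF l_def that(2)] by (intro T_sum_mgf) auto
    also have "\<dots> \<le> ennreal (\<Prod>i\<in>{j..<n}. exp (1 / (2 * \<kappa>\<^sup>2) * p i))"
      using step_less[OF l_def that(2)] step[OF l_def that(2)] r_pos
      by (intro ennreal_leI prod_mono conjI mult_nonneg_nonneg divide_nonneg_nonneg) (auto simp: less_imp_le)
    also have "\<dots> = ennreal (exp (1 / (2 * \<kappa>\<^sup>2) * (\<Sum>i\<in>{j..<n}. p i)))"
      by (simp add: exp_sum sum_distrib_left)
    also have "\<dots> \<le> ennreal C"
      unfolding C_def using summ p
      by (auto intro!: ennreal_leI mult_left_mono sum_le_suminf divide_right_mono)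
    finally show ?thesis unfolding l_def .
  qed
  show thesis
  proof (rule convergence_of_exp_increments[of X \<kappa> "1 / 4" C])
    fix X'
    assume X': "X' \<in> borel_measurable M" "AE \<omega> in M. (\<lambda>n. X n \<omega>) \<longlonglongrightarrow> X' \<omega>"
    show thesis
    proof (rule that[of "\<lambda>\<omega>. ln r - X' \<omega>"])
      show "AE \<omega> in M. (\<lambda>n. ln (r + real n) - S * jump_time n \<omega>) \<longlonglongrightarrow> ln r - X' \<omega>"
        using X'(2)
      proof eventually_elim
        case (elim \<omega>)
        then have "(\<lambda>n. ln r - X n \<omega>) \<longlonglongrightarrow> ln r - X' \<omega>" by (intro tendsto_intros)
        then show ?case by (simp add: X_eq algebra_simps)
      qed
    qed (use X'(1) in simp)
  qed (use bound \<kappa>(1) in \<open>auto simp: C_def simp del: of_nat_Suc\<close>)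
qed

text \<open>
  Markov's inequality for \<open>exp (- q * S * jump_time n)\<close>, whose mean is
  \<open>pochhammer r n / pochhammer (r + q) n = pochhammer r q / pochhammer (r + n) q\<close>.
\<close>

lemma jump_time_tail:
  fixes q n :: nat and t :: real
  shows "emeasure M {\<omega> \<in> space M. jump_time n \<omega> \<le> t} \<le>
    ennreal (exp (q * (S * t)) * pochhammer r q / (r + real n) ^ q)"
proof -
  have "emeasure M {\<omega> \<in> space M. jump_time n \<omega> \<le> t} = (\<integral>\<^sup>+\<omega>. indicator {\<omega> \<in> space M. jump_time n \<omega> \<le> t} \<omega> \<partial>M)"
    by simp
  also have "\<dots> \<le> (\<integral>\<^sup>+\<omega>. ennreal (exp (q * (S * t))) * ennreal (exp ((- real q) * (\<Sum>i<n. S * T i \<omega> - 0))) \<partial>M)"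
  proof (intro nn_integral_mono)
    fix \<omega>
    have "1 \<le> exp (q * (S * t)) * exp ((- real q) * (\<Sum>i<n. S * T i \<omega> - 0))" if "jump_time n \<omega> \<le> t"
    proof -
      have "real q * (S * jump_time n \<omega>) \<le> real q * (S * t)"
        using that S_pos by (intro mult_left_mono) auto
      moreover have "(- real q) * (\<Sum>i<n. S * T i \<omega> - 0) = - (real q * (S * jump_time n \<omega>))"
        by (simp add: jump_time_def sum_distrib_left sum_negf)
      ultimately show ?thesis by (simp only: exp_add[symmetric]) simp
    qed
    then have "1 \<le> ennreal (exp (q * (S * t))) * ennreal (exp ((- real q) * (\<Sum>i<n. S * T i \<omega> - 0)))"
      if "jump_time n \<omega> \<le> t"
      using that by (simp flip: ennreal_mult ennreal_1 add: ennreal_leI)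
    then show "indicator {\<omega> \<in> space M. jump_time n \<omega> \<le> t} \<omega> \<le>
        ennreal (exp (q * (S * t))) * ennreal (exp ((- real q) * (\<Sum>i<n. S * T i \<omega> - 0)))"
      by (auto split: split_indicator)
  qed
  also have "\<dots> = ennreal (exp (q * (S * t))) * ennreal (\<Prod>i<n. (r + real i) / (r + real i + real q))"
    using r_pos T_sum_mgf[of "{..<n}" "- real q" "\<lambda>_. 0"] by (simp add: nn_integral_cmult)
  also have "(\<Prod>i<n. (r + real i) / (r + real i + real q)) = pochhammer r n / pochhammer (r + real q) n"
    by (simp add: pochhammer_prod prod_dividef atLeast0LessThan algebra_simps)
  also have "\<dots> = pochhammer r q / pochhammer (r + real n) q"
    using pochhammer_product'[of r n q] pochhammer_product'[of r q n] r_pos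
    by (simp add: add.commute pochhammer_pos less_imp_neq[symmetric] frac_eq_eq add_pos_nonneg mult.commute)
  also have "ennreal (exp (q * (S * t))) * ennreal (pochhammer r q / pochhammer (r + real n) q) =
      ennreal (exp (q * (S * t)) * (pochhammer r q / pochhammer (r + real n) q))"
    using r_pos by (intro ennreal_mult[symmetric] divide_nonneg_nonneg pochhammer_nonneg) auto
  also have "\<dots> \<le> ennreal (exp (q * (S * t)) * (pochhammer r q / (r + real n) ^ q))"
  proof (intro ennreal_leI mult_left_mono divide_left_mono)
    have "(\<Prod>i<q. r + real n) \<le> (\<Prod>i<q. r + real n + real i)"
      using r_pos by (intro prod_mono) auto
    then show "(r + real n) ^ q \<le> pochhammer (r + real n) q"
      by (simp add: pochhammer_prod atLeast0LessThan)
  qed (use r_pos in \<open>auto intro!: pochhammer_nonneg mult_pos_pos pochhammer_pos\<close>)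
  finally show ?thesis by simp
qed

lemma char_T:
  "char (distr M borel (\<lambda>\<omega>. - (S * T i \<omega>))) t = (r + real i) / (r + real i + \<i> * t)"
proof -
  define l where "l = S * (r + real i)"
  have pos: "0 < l" "0 < real_of_int S" using r_pos S_pos by (auto simp: l_def)
  have "char (distr M borel (\<lambda>\<omega>. - (S * T i \<omega>))) t = (CLINT \<omega>|M. iexp (- t * S * T i \<omega>))"
    by (simp add: char_def integral_distr mult_ac)
  also have "\<dots> = (CLINT x|distr M lborel (T i). iexp (- t * S * x))"
    by (subst integral_distr) auto
  also have "\<dots> = (CLINT x|lborel. exponential_density l x *\<^sub>R iexp (- t * S * x))"
    using pos distributed_distr_eq_density[OF T_exponential[of i]]
    by (simp only: l_def[symmetric]) (subst integral_density, auto simp: exponential_density_nonneg)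
  also have "\<dots> = l / (l - \<i> * complex_of_real (- t * S))"
    by (rule complex_integral_exponential_density) (rule pos)
  also have "\<dots> = (of_real S * (r + real i)) / (of_real S * (r + real i + \<i> * t))"
    by (simp add: l_def algebra_simps)
  also have "\<dots> = (r + real i) / (r + real i + \<i> * t)"
    using S_pos by simp
  finally show ?thesis .
qed

text \<open>
  The product of the Fourier transforms of the first \<open>n + 1\<close> holding times is the quotient of two
  Gauss products for the Gamma function, at \<open>r + i t\<close> and at \<open>r\<close>.
\<close>

lemma char_jump_time_limit:
  assumes [measurable]: "L \<in> borel_measurable M"
    and L: "AE \<omega> in M. (\<lambda>n. ln (r + real n) - S * jump_time n \<omega>) \<longlonglongrightarrow> L \<omega>"
  shows "char (distr M borel L) t = Gamma (r + \<i> * t) / Gamma (complex_of_real r)"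
proof -
  define z where "z = complex_of_real r + \<i> * t"
  have nonpos: "z \<notin> \<int>\<^sub>\<le>\<^sub>0" "complex_of_real r \<notin> \<int>\<^sub>\<le>\<^sub>0"
    using r_pos by (auto simp: z_def elim!: nonpos_Ints_cases simp: complex_eq_iff)
  define X where "X n \<omega> = ln (real n) - S * jump_time (n + 1) \<omega>" for n \<omega>
  have [measurable]: "X n \<in> borel_measurable M" for n by (simp add: X_def[abs_def])
  have X_lim: "AE \<omega> in M. (\<lambda>n. X n \<omega>) \<longlonglongrightarrow> L \<omega>"
    using L
  proof eventually_elim
    case (elim \<omega>)
    have "(\<lambda>n. - ln (1 + (r + 1) / real n)) \<longlonglongrightarrow> - ln (1 + 0)"
      by (intro tendsto_intros) (auto intro: lim_const_over_n)
    then have "(\<lambda>n. (ln (r + real (n + 1)) - S * jump_time (n + 1) \<omega>) + - ln (1 + (r + 1) / real n)) \<longlonglongrightarrow> L \<omega> + 0"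
      by (intro tendsto_add LIMSEQ_ignore_initial_segment[OF elim, of 1]) simp_all
    then have "(\<lambda>n. (ln (r + real (n + 1)) - S * jump_time (n + 1) \<omega>) + - ln (1 + (r + 1) / real n)) \<longlonglongrightarrow> L \<omega>"
      by simp
    then show ?case
    proof (rule Lim_transform_eventually)
      show "eventually (\<lambda>n. (ln (r + real (n + 1)) - S * jump_time (n + 1) \<omega>) + - ln (1 + (r + 1) / real n) = X n \<omega>) sequentially"
        using eventually_gt_at_top[of 0]
      proof eventually_elim
        case (elim n)
        then have "1 + (r + 1) / real n = (r + real (n + 1)) / real n" by (simp add: field_simps)
        then show ?case using elim r_pos by (simp add: X_def ln_div)
      qed
    qed
  qed
  have char_X: "char (distr M borel (X n)) t = Gamma_series z n / Gamma_series (complex_of_real r) n" for n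
  proof -
    have ind: "indep_vars (\<lambda>_. borel) (\<lambda>i \<omega>. - (S * T i \<omega>)) {..<n + 1}"
      by (rule indep_vars_compose2[OF T_indep]) simp
    have X_eq: "X n \<omega> = ln (real n) + (\<Sum>i<n + 1. - (S * T i \<omega>))" for \<omega>
      by (simp add: X_def jump_time_def sum_distrib_left sum_negf algebra_simps)
    have "char (distr M borel (X n)) t =
        iexp (t * ln (real n)) * char (distr M borel (\<lambda>\<omega>. \<Sum>i<n + 1. - (S * T i \<omega>))) t"
      by (simp add: char_def integral_distr X_eq exp_add distrib_left del: sum.lessThan_Suc)
    also have "\<dots> = iexp (t * ln (real n)) * (\<Prod>i<n + 1. (complex_of_real r + of_nat i) / (z + of_nat i))"
      unfolding char_distr_sum[OF ind] char_T
      by (simp add: z_def algebra_simps del: prod.lessThan_Suc)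
    also have "(\<Prod>i<n + 1. (complex_of_real r + of_nat i) / (z + of_nat i)) =
        pochhammer (complex_of_real r) (n + 1) / pochhammer z (n + 1)"
      by (simp add: pochhammer_prod prod_dividef atLeast0LessThan del: prod.lessThan_Suc)
    also have "iexp (t * ln (real n)) = exp (z * of_real (ln (real n))) / exp (complex_of_real r * of_real (ln (real n)))"
      by (simp add: exp_diff[symmetric] z_def algebra_simps)
    finally show ?thesis by (simp add: Gamma_series_def)
  qed
  have "(\<lambda>n. Gamma_series z n / Gamma_series (complex_of_real r) n) \<longlonglongrightarrow> Gamma z / Gamma (complex_of_real r)"
    using nonpos by (intro tendsto_intros) (auto simp: Gamma_eq_zero_iff)
  moreover have "(\<lambda>n. char (distr M borel (X n)) t) \<longlonglongrightarrow> char (distr M borel L) t"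
    unfolding char_def
  proof (subst (1 2) integral_distr)
    show "(\<lambda>n. CLINT \<omega>|M. iexp (t * X n \<omega>)) \<longlonglongrightarrow> (CLINT \<omega>|M. iexp (t * L \<omega>))"
    proof (rule integral_dominated_convergence[where w = "\<lambda>_. 1"])
      show "AE \<omega> in M. (\<lambda>n. iexp (t * X n \<omega>)) \<longlonglongrightarrow> iexp (t * L \<omega>)"
        using X_lim by eventually_elim (intro tendsto_intros)
    qed auto
  qed auto
  ultimately show ?thesis
    unfolding char_X z_def by (metis LIMSEQ_unique)
qed

end

section \<open>The second coordinate along the jump chain\<close>

text \<open>
  Hoeffding's lemma for a centred variable with the two values \<open>1 - p\<close> and \<open>- p\<close>.
\<close>

lemma two_point_hoeffding:
  fixes p h :: real
  assumes "0 \<le> p" "p \<le> 1"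
  shows "p * exp (h * (1 - p)) + (1 - p) * exp (- (h * p)) \<le> exp (h\<^sup>2 / 8)"
proof -
  have *: "p * exp (h * (1 - p)) + (1 - p) * exp (- (h * p)) \<le> exp (h\<^sup>2 / 8)"
    if "0 \<le> h" "0 \<le> p" "p \<le> 1" for p h :: real
  proof -
    have pos: "0 < 1 + p * (exp h - 1)"
      using that by (intro add_pos_nonneg) auto
    have "p * exp (h * (1 - p)) + (1 - p) * exp (- (h * p)) = exp (- (h * p)) * (1 + p * (exp h - 1))"
      by (simp add: algebra_simps exp_diff exp_minus field_simps)
    also have "\<dots> = exp (- h * p + ln (1 + p * (exp h - 1)))"
      unfolding exp_add using pos by simp
    also have "\<dots> \<le> exp (h\<^sup>2 / 8)"
      using Hoeffdings_lemma_aux[of h p] that by simp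
    finally show ?thesis .
  qed
  show ?thesis
    using *[of h p] *[of "- h" "1 - p"] assms by (cases "0 \<le> h") (auto simp: add.commute)
qed

context urn_jump_chain
begin

definition \<sigma> :: real where "\<sigma> = m / S"

lemma \<sigma>_bounds: "1 / 2 < \<sigma>" "\<sigma> < 1" "0 < \<sigma>"
  using S_pos S_less m_less by (auto simp: \<sigma>_def field_simps)

definition form2 :: "nat \<times> nat \<Rightarrow> real" where
  "form2 z = u2 S b c (vec2 z)"

lemma form2_red: "form2 (red z) = form2 z + \<sigma> * b" and form2_black: "form2 (black z) = form2 z - \<sigma> * c"
proof -
  have a: "real (nat a) = of_int c + m" "real (nat b) = b" "real (nat c) = c" "real (nat d) = of_int b + m"
    using entries by auto
  show "form2 (red z) = form2 z + \<sigma> * b" "form2 (black z) = form2 z - \<sigma> * c"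
    using S_pos by (simp_all add: form2_def u2_def vec2_def red_def black_def a \<sigma>_def field_simps)
qed

text \<open>
  The factor by which the mean of \<open>form2 (Y n)\<close> grows in \<open>n\<close> jumps.
\<close>

definition growth :: "nat \<Rightarrow> real" where
  "growth n = (\<Prod>i<n. 1 + \<sigma> / (r + real i))"

lemma growth_pos: "0 < growth n"
  unfolding growth_def using \<sigma>_bounds r_pos by (intro prod_pos) (auto intro!: add_pos_nonneg)

text \<open>
  The product is \<open>pochhammer (r + \<sigma>) n / pochhammer r n\<close>, a quotient of two Gauss products.
\<close>

lemma growth_asymp: "(\<lambda>n. growth n / (r + real n) powr \<sigma>) \<longlonglongrightarrow> Gamma r / Gamma (r + \<sigma>)"
proof -
  have "0 < r + \<sigma>" using r_pos \<sigma>_bounds by simp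
  have "Gamma (r + \<sigma>) \<noteq> 0" using Gamma_real_pos[OF \<open>0 < r + \<sigma>\<close>] by simp
  then have "(\<lambda>n. Gamma_series r n / Gamma_series (r + \<sigma>) n * (real n / (r + real (Suc n))) powr \<sigma>)
      \<longlonglongrightarrow> Gamma r / Gamma (r + \<sigma>) * 1 powr \<sigma>"
  proof (intro tendsto_mult tendsto_divide Gamma_series_LIMSEQ tendsto_powr tendsto_const)
    have "(\<lambda>n. 1 / (1 + (r + 1) / real n)) \<longlonglongrightarrow> 1 / (1 + 0)"
      by (intro tendsto_intros) (auto intro: lim_const_over_n)
    then have "(\<lambda>n. 1 / (1 + (r + 1) / real n)) \<longlonglongrightarrow> 1" by simp
    then show "(\<lambda>n. real n / (r + real (Suc n))) \<longlonglongrightarrow> 1"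
      by (rule Lim_transform_eventually)
        (use eventually_gt_at_top[of 0] in \<open>eventually_elim, simp add: field_simps\<close>)
  qed auto
  then have "(\<lambda>n. Gamma_series r n / Gamma_series (r + \<sigma>) n * (real n / (r + real (Suc n))) powr \<sigma>)
      \<longlonglongrightarrow> Gamma r / Gamma (r + \<sigma>)" by simp
  then have "(\<lambda>n. growth (Suc n) / (r + real (Suc n)) powr \<sigma>) \<longlonglongrightarrow> Gamma r / Gamma (r + \<sigma>)"
  proof (rule Lim_transform_eventually)
    show "eventually (\<lambda>n. Gamma_series r n / Gamma_series (r + \<sigma>) n * (real n / (r + real (Suc n))) powr \<sigma> =
        growth (Suc n) / (r + real (Suc n)) powr \<sigma>) sequentially"
      using eventually_gt_at_top[of 0]
    proof eventually_elim
      case (elim n)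
      have "growth (Suc n) = (\<Prod>i<Suc n. (r + \<sigma> + real i) / (r + real i))"
        unfolding growth_def
      proof (rule prod.cong)
        fix i
        have "0 < r + real i" using r_pos by simp
        then show "1 + \<sigma> / (r + real i) = (r + \<sigma> + real i) / (r + real i)" by (simp add: field_simps)
      qed simp
      also have "\<dots> = pochhammer (r + \<sigma>) (Suc n) / pochhammer r (Suc n)"
        by (simp add: pochhammer_prod prod_dividef atLeast0LessThan del: prod.lessThan_Suc)
      also have "\<dots> = Gamma_series r n / Gamma_series (r + \<sigma>) n * real n powr \<sigma>"
      proof -
        have p: "pochhammer (r + \<sigma>) (Suc n) > 0" "pochhammer r (Suc n) > 0"
          using r_pos \<open>0 < r + \<sigma>\<close> by (auto intro: pochhammer_pos)
        have e: "exp ((r + \<sigma>) * ln (real n)) = exp (r * ln (real n)) * real n powr \<sigma>"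
          using elim by (simp add: powr_def exp_add[symmetric] algebra_simps)
        show ?thesis
          using p elim by (simp add: Gamma_series_def e del: of_nat_Suc)
      qed
      finally show ?case using elim r_pos by (simp add: powr_divide)
    qed
  qed
  then show ?thesis by (simp only: filterlim_sequentially_Suc[of "\<lambda>n. growth n / (r + real n) powr \<sigma>"])
qed

lemma growth_bounds:
  obtains c1 c2 where "0 < c1" "0 < c2"
    and "\<And>n. c1 * (r + real n) powr \<sigma> \<le> growth n" "\<And>n. growth n \<le> c2 * (r + real n) powr \<sigma>"
proof -
  define f where "f n = growth n / (r + real n) powr \<sigma>" for n
  define g where "g = Gamma r / Gamma (r + \<sigma>)"
  have g: "0 < g" using r_pos \<sigma>_bounds by (auto simp: g_def intro!: divide_pos_pos Gamma_real_pos)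
  have pos: "0 < (r + real n) powr \<sigma>" for n using r_pos by (simp add: add_pos_nonneg less_imp_neq[symmetric])
  have f: "0 < f n" for n using growth_pos pos by (simp add: f_def)
  have lim: "f \<longlonglongrightarrow> g" using growth_asymp by (simp add: f_def[abs_def] g_def)
  obtain c2 where c2: "0 < c2" "\<And>n. norm (f n) \<le> c2"
    using convergent_imp_Bseq[OF convergentI[OF lim]] by (auto elim: BseqE)
  have "(\<lambda>n. inverse (f n)) \<longlonglongrightarrow> inverse g" using lim g by (intro tendsto_intros) auto
  then have "Bseq (\<lambda>n. inverse (f n))" by (rule convergent_imp_Bseq[OF convergentI])
  then obtain k where k: "0 < k" "\<And>n. norm (inverse (f n)) \<le> k" by (auto elim: BseqE)
  show thesis
  proof (rule that[of "1 / k" c2])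
    show "1 / k * (r + real n) powr \<sigma> \<le> growth n" for n
    proof -
      have "1 / k \<le> f n" using k(2)[of n] f[of n] \<open>0 < k\<close> by (simp add: field_simps)
      then show ?thesis using pos[of n] by (simp add: f_def field_simps)
    qed
    show "growth n \<le> c2 * (r + real n) powr \<sigma>" for n
      using c2(2)[of n] f[of n] pos[of n] by (simp add: f_def field_simps)
  qed (use k c2 in auto)
qed

definition Mart :: "nat \<Rightarrow> 'w \<Rightarrow> real" where
  "Mart n \<omega> = form2 (Y n \<omega>) / growth n"

lemma Mart_measurable[measurable]: "Mart n \<in> borel_measurable M"
  unfolding Mart_def[abs_def] by measurable

text \<open>
  Let \<open>p\<close> be the proportion of red balls.  Then \<open>form2 (Y n) = (r + n) * (b * p - c * (1 - p))\<close>, so that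
  the increment of \<open>Mart\<close> is \<open>\<sigma> * (b + c) / growth (Suc n)\<close> times \<open>1 - p\<close> if a red ball is drawn and
  times \<open>- p\<close> otherwise: it is centred and Hoeffding's lemma applies.
\<close>

lemma Mart_step:
  fixes l :: real
  assumes "j \<le> n"
  shows "(\<integral>\<^sup>+\<omega>. ennreal (exp (l * (Mart (Suc n) \<omega> - Mart j \<omega>))) \<partial>M) \<le>
    ennreal (exp ((l * (\<sigma> * (b + c)))\<^sup>2 / (8 * (growth (Suc n))\<^sup>2))) *
    (\<integral>\<^sup>+\<omega>. ennreal (exp (l * (Mart n \<omega> - Mart j \<omega>))) \<partial>M)"
proof -
  define h where "h = l * (\<sigma> * (b + c)) / growth (Suc n)"
  define F where "F v z = ennreal (exp (l * (form2 z / growth (Suc n) - form2 (v ! j) / growth j)))"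
    for v :: "(nat \<times> nat) list" and z
  have "(\<integral>\<^sup>+\<omega>. ennreal (exp (l * (Mart (Suc n) \<omega> - Mart j \<omega>))) \<partial>M) =
      (\<integral>\<^sup>+\<omega>. F (history n \<omega>) (Y (Suc n) \<omega>) \<partial>M)"
    using assms by (simp add: F_def Mart_def history_nth)
  also have "\<dots> = (\<integral>\<^sup>+\<omega>. ennreal (real (fst (Y n \<omega>)) / real (balls (Y n \<omega>))) * F (history n \<omega>) (red (Y n \<omega>)) +
           ennreal (real (snd (Y n \<omega>)) / real (balls (Y n \<omega>))) * F (history n \<omega>) (black (Y n \<omega>)) \<partial>M)"
    by (rule markov_property)
  also have "\<dots> \<le> (\<integral>\<^sup>+\<omega>. ennreal (exp (h\<^sup>2 / 8)) * ennreal (exp (l * (Mart n \<omega> - Mart j \<omega>))) \<partial>M)"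
  proof (rule nn_integral_mono_AE)
    show "AE \<omega> in M. ennreal (real (fst (Y n \<omega>)) / real (balls (Y n \<omega>))) * F (history n \<omega>) (red (Y n \<omega>)) +
           ennreal (real (snd (Y n \<omega>)) / real (balls (Y n \<omega>))) * F (history n \<omega>) (black (Y n \<omega>))
         \<le> ennreal (exp (h\<^sup>2 / 8)) * ennreal (exp (l * (Mart n \<omega> - Mart j \<omega>)))"
      using AE_balls_Y
    proof eventually_elim
      case (elim \<omega>)
      define x where "x = real (fst (Y n \<omega>))"
      define y where "y = real (snd (Y n \<omega>))"
      define N where "N = real (balls (Y n \<omega>))"
      define p where "p = x / N"
      define G where "G = growth (Suc n)"
      define f where "f = form2 (Y n \<omega>)"
      define E where "E = exp (l * (Mart n \<omega> - Mart j \<omega>))"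
      have rn: "0 < r + real n" using r_pos by simp
      have N: "N = S * (r + real n)" "N = x + y" "0 < N"
        using elim rn S_pos by (auto simp: N_def balls_def x_def y_def)
      have p: "0 \<le> p" "p \<le> 1" "y / N = 1 - p"
        using N by (auto simp: p_def x_def y_def field_simps)
      have G: "0 < G" "G = growth n * (1 + \<sigma> / (r + real n))"
        using growth_pos[of "Suc n"] by (auto simp: G_def growth_def)
      have f: "f = (r + real n) * (b * p - c * (1 - p))"
      proof -
        have "f = (b * x - c * y) / S" by (simp add: f_def form2_def u2_def vec2_def x_def y_def)
        also have "x = N * p" using N(3) by (simp add: p_def)
        also have "y = N * (1 - p)" using p(3) N(3) by (simp add: field_simps)
        also have "(b * (N * p) - c * (N * (1 - p))) / S = (N / S) * (b * p - c * (1 - p))"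
          by (simp add: diff_divide_distrib right_diff_distrib mult_ac)
        also have "N / S = r + real n" using S_pos N(1) by simp
        finally show ?thesis .
      qed
      have fg: "f / growth n = (f + \<sigma> * (b * p - c * (1 - p))) / G"
      proof -
        have "f / growth n = f * (1 + \<sigma> / (r + real n)) / G"
          using growth_pos[of n] \<sigma>_bounds rn by (simp add: G(2) add_pos_pos less_imp_neq[symmetric])
        also have "f * (1 + \<sigma> / (r + real n)) = f + \<sigma> * (b * p - c * (1 - p))"
          using rn by (simp add: f field_simps)
        finally show ?thesis .
      qed
      have red: "F (history n \<omega>) (red (Y n \<omega>)) = ennreal (E * exp (h * (1 - p)))"
      proof -
        have "(f + \<sigma> * b) / G = f / growth n + \<sigma> * (b + c) / G * (1 - p)"
          unfolding fg using G(1) by (simp add: field_simps)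
        then show ?thesis
          using assms unfolding F_def E_def exp_add[symmetric]
          by (simp add: form2_red history_nth Mart_def h_def flip: G_def f_def) (simp add: algebra_simps)
      qed
      have black: "F (history n \<omega>) (black (Y n \<omega>)) = ennreal (E * exp (- (h * p)))"
      proof -
        have "(f - \<sigma> * c) / G = f / growth n - \<sigma> * (b + c) / G * p"
          unfolding fg using G(1) by (simp add: field_simps)
        then show ?thesis
          using assms unfolding F_def E_def exp_add[symmetric]
          by (simp add: form2_black history_nth Mart_def h_def flip: G_def f_def) (simp add: algebra_simps)
      qed
      have "ennreal (x / N) * ennreal (E * exp (h * (1 - p))) + ennreal (y / N) * ennreal (E * exp (- (h * p))) =
          ennreal (E * (p * exp (h * (1 - p)) + (1 - p) * exp (- (h * p))))"
        unfolding p(3) p_def[symmetric] using p(1,2)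
        by (simp add: E_def algebra_simps flip: ennreal_mult ennreal_plus)
      also have "\<dots> \<le> ennreal (E * exp (h\<^sup>2 / 8))"
        using two_point_hoeffding[OF p(1,2)] by (intro ennreal_leI mult_left_mono) (auto simp: E_def)
      also have "\<dots> = ennreal (exp (h\<^sup>2 / 8)) * ennreal E"
        by (simp add: E_def mult.commute flip: ennreal_mult)
      finally show ?case
        unfolding red black by (simp only: x_def y_def N_def E_def)
    qed
  qed
  also have "\<dots> = ennreal (exp (h\<^sup>2 / 8)) * (\<integral>\<^sup>+\<omega>. ennreal (exp (l * (Mart n \<omega> - Mart j \<omega>))) \<partial>M)"
    by (rule nn_integral_cmult) simp
  also have "h\<^sup>2 / 8 = (l * (\<sigma> * (b + c)))\<^sup>2 / (8 * (growth (Suc n))\<^sup>2)"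
    by (simp add: h_def power_divide)
  finally show ?thesis .
qed

lemma Mart_exp_increments:
  fixes l :: real
  assumes "j \<le> n"
  shows "(\<integral>\<^sup>+\<omega>. ennreal (exp (l * (Mart n \<omega> - Mart j \<omega>))) \<partial>M) \<le>
    ennreal (exp ((l * (\<sigma> * (b + c)))\<^sup>2 / 8 * (\<Sum>i\<in>{j..<n}. 1 / (growth (Suc i))\<^sup>2)))"
  using assms
proof (induction n rule: dec_induct)
  case base
  then show ?case by (simp add: emeasure_space_1)
next
  case (step n)
  let ?e = "(l * (\<sigma> * (b + c)))\<^sup>2 / 8"
  have "(\<integral>\<^sup>+\<omega>. ennreal (exp (l * (Mart (Suc n) \<omega> - Mart j \<omega>))) \<partial>M) \<le>
      ennreal (exp (?e * (1 / (growth (Suc n))\<^sup>2))) * ennreal (exp (?e * (\<Sum>i\<in>{j..<n}. 1 / (growth (Suc i))\<^sup>2)))"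
    using order_trans[OF Mart_step[OF step(1), of l] mult_left_mono[OF step.IH]] by simp
  also have "\<dots> = ennreal (exp (?e * (\<Sum>i\<in>{j..<Suc n}. 1 / (growth (Suc i))\<^sup>2)))"
    using step(1) by (simp add: exp_add[symmetric] algebra_simps flip: ennreal_mult)
  finally show ?case .
qed

text \<open>
  For \<open>l = j powr \<delta>\<close> the exponents in \<open>Mart_exp_increments\<close> are bounded by a multiple of the sum of
  \<open>i powr (2 * \<delta> - 2 * \<sigma>)\<close>.  The choice \<open>2 * \<delta> = \<sigma> - 1 / 2\<close> is positive and makes this sum finite,
  both because \<open>\<sigma> > 1 / 2\<close>.
\<close>

lemma Mart_converges:
  obtains W k0 D where "W \<in> borel_measurable M"
    and "AE \<omega> in M. (\<lambda>n. Mart n \<omega>) \<longlonglongrightarrow> W \<omega>"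
    and "\<And>k::nat. D k \<in> borel_measurable M"
    and "\<And>k. k0 \<le> k \<Longrightarrow> (\<integral>\<^sup>+\<omega>. D k \<omega> \<partial>M) < \<infinity>"
    and "\<And>k. AE \<omega> in M. \<forall>n. ennreal (Mart n \<omega> ^ (2 * k)) \<le> D k \<omega>"
proof -
  obtain c1 c2 where c: "0 < c1" "\<And>n. c1 * (r + real n) powr \<sigma> \<le> growth n" using growth_bounds by metis
  define \<delta> where "\<delta> = (2 * \<sigma> - 1) / 4"
  have \<delta>: "0 < \<delta>" using \<sigma>_bounds by (simp add: \<delta>_def)
  have \<delta>_eq: "2 * \<delta> = \<sigma> - 1 / 2" by (simp add: \<delta>_def field_simps)
  define p where "p i = real (Suc i) powr (2 * \<delta> - 2 * \<sigma>)" for i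
  have summ: "summable p" unfolding p_def using \<sigma>_bounds \<delta>_eq by (intro summable_powr_Suc) linarith
  have p: "0 \<le> p i" for i by (simp add: p_def)
  define K where "K = (\<sigma> * (b + c))\<^sup>2 / 8"
  have K: "0 \<le> K" by (simp add: K_def)
  define C where "C = exp (K / c1\<^sup>2 * (\<Sum>i. p i))"
  have bound: "(\<integral>\<^sup>+\<omega>. ennreal (exp (s * (1 * real (Suc j) powr \<delta>) * (Mart n \<omega> - Mart j \<omega>))) \<partial>M) \<le> ennreal C"
    if "j \<le> n" "s \<in> {-1, 1}" for s j n
  proof -
    define l where "l = s * (1 * real (Suc j) powr \<delta>)"
    have l: "l\<^sup>2 = real (Suc j) powr (2 * \<delta>)"
      using that(2) by (auto simp: l_def power2_eq_square powr_add[symmetric] simp del: of_nat_Suc)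
    have "(l * (\<sigma> * (b + c)))\<^sup>2 / 8 * (\<Sum>i\<in>{j..<n}. 1 / (growth (Suc i))\<^sup>2) =
        K * (\<Sum>i\<in>{j..<n}. l\<^sup>2 / (growth (Suc i))\<^sup>2)"
      by (simp add: K_def power_mult_distrib sum_distrib_left mult_ac)
    also have "\<dots> \<le> K * (\<Sum>i\<in>{j..<n}. p i / c1\<^sup>2)"
    proof (intro mult_left_mono sum_mono K)
      fix i assume i: "i \<in> {j..<n}"
      have "real (Suc i) powr \<sigma> \<le> (r + real (Suc i)) powr \<sigma>"
        using \<sigma>_bounds r_pos by (intro powr_mono2) auto
      then have "c1 * real (Suc i) powr \<sigma> \<le> growth (Suc i)"
        using c(2)[of "Suc i"] \<open>0 < c1\<close> by (meson mult_left_mono less_imp_le order_trans)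
      then have "(c1 * real (Suc i) powr \<sigma>)\<^sup>2 \<le> (growth (Suc i))\<^sup>2"
        using \<open>0 < c1\<close> by (intro power_mono) auto
      moreover have "l\<^sup>2 \<le> real (Suc i) powr (2 * \<delta>)"
        unfolding l using i \<delta> by (intro powr_mono2) auto
      ultimately have "l\<^sup>2 / (growth (Suc i))\<^sup>2 \<le> real (Suc i) powr (2 * \<delta>) / (c1 * real (Suc i) powr \<sigma>)\<^sup>2"
        using \<open>0 < c1\<close> by (intro frac_le) auto
      also have "(c1 * real (Suc i) powr \<sigma>)\<^sup>2 = c1\<^sup>2 * real (Suc i) powr (2 * \<sigma>)"
        by (simp add: power_mult_distrib power2_eq_square powr_add[symmetric] del: of_nat_Suc)
      also have "real (Suc i) powr (2 * \<delta>) / (c1\<^sup>2 * real (Suc i) powr (2 * \<sigma>)) = p i / c1\<^sup>2"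
        by (simp add: p_def powr_diff field_simps del: of_nat_Suc)
      finally show "l\<^sup>2 / (growth (Suc i))\<^sup>2 \<le> p i / c1\<^sup>2" .
    qed
    also have "\<dots> = K / c1\<^sup>2 * (\<Sum>i\<in>{j..<n}. p i)"
      by (simp add: sum_divide_distrib[symmetric])
    also have "\<dots> \<le> K / c1\<^sup>2 * (\<Sum>i. p i)"
      using K summ p by (intro mult_left_mono sum_le_suminf) auto
    finally have "exp ((l * (\<sigma> * (b + c)))\<^sup>2 / 8 * (\<Sum>i\<in>{j..<n}. 1 / (growth (Suc i))\<^sup>2)) \<le> C"
      by (simp add: C_def)
    then show ?thesis
      using Mart_exp_increments[OF that(1), of l] unfolding l_def by (meson ennreal_leI order_trans)
  qed
  show thesis
  proof (rule convergence_of_exp_increments[of Mart 1 \<delta> C])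
    fix W k0 D
    assume W: "W \<in> borel_measurable M" "AE \<omega> in M. (\<lambda>n. Mart n \<omega>) \<longlonglongrightarrow> W \<omega>"
      and D[measurable]: "\<And>k::nat. D k \<in> borel_measurable M"
      and fin: "\<And>k. k0 \<le> k \<Longrightarrow> (\<integral>\<^sup>+\<omega>. D k \<omega> \<partial>M) < \<infinity>"
      and le: "\<And>n k \<omega>. ennreal ((Mart n \<omega> - Mart 0 \<omega>) ^ (2 * k)) \<le> D k \<omega>"
    define D' where "D' k \<omega> = ennreal (2 ^ (2 * k)) * (D k \<omega> + ennreal (form2 z0 ^ (2 * k)))" for k \<omega>
    show thesis
    proof (rule that[of W D' k0])
      show "D' k \<in> borel_measurable M" for k unfolding D'_def[abs_def] by measurable
      show "(\<integral>\<^sup>+\<omega>. D' k \<omega> \<partial>M) < \<infinity>" if "k0 \<le> k" for k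
        using fin[OF that] unfolding D'_def
        by (simp add: nn_integral_cmult nn_integral_add emeasure_space_1 ennreal_mult_less_top)
      show "AE \<omega> in M. \<forall>n. ennreal (Mart n \<omega> ^ (2 * k)) \<le> D' k \<omega>" for k
        using AE_Y0
      proof eventually_elim
        case (elim \<omega>)
        have M0: "Mart 0 \<omega> = form2 z0" using elim by (simp add: Mart_def growth_def)
        show ?case
        proof
          fix n
          have "Mart n \<omega> ^ (2 * k) \<le> 2 ^ (2 * k) * ((Mart n \<omega> - Mart 0 \<omega>) ^ (2 * k) + form2 z0 ^ (2 * k))"
            using power_even_add_le[of "Mart n \<omega> - Mart 0 \<omega>" "Mart 0 \<omega>" k] by (simp add: M0)
          then have "ennreal (Mart n \<omega> ^ (2 * k)) \<le>
              ennreal (2 ^ (2 * k)) * (ennreal ((Mart n \<omega> - Mart 0 \<omega>) ^ (2 * k)) + ennreal (form2 z0 ^ (2 * k)))"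
            by (subst ennreal_plus[symmetric], simp, simp, subst ennreal_mult[symmetric], simp, simp, rule ennreal_leI)
          also have "\<dots> \<le> D' k \<omega>"
            unfolding D'_def by (intro mult_left_mono add_mono le) auto
          finally show "ennreal (Mart n \<omega> ^ (2 * k)) \<le> D' k \<omega>" .
        qed
      qed
    qed (use W in auto)
  qed (use bound \<delta> in \<open>auto simp: C_def simp del: of_nat_Suc\<close>)
qed

end

section \<open>The urn in continuous time\<close>

text \<open>
  \<open>N t\<close> counts the terms of \<open>\<tau>\<close> after \<open>\<tau> 0\<close> up to time \<open>t\<close>.  The quantity \<open>exp (- s * t) * (r + N t)\<close> lies between the
  values obtained by replacing \<open>t\<close> with \<open>\<tau> (N t)\<close> and with \<open>\<tau> (Suc (N t))\<close>, both of which tend to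
  \<open>exp L\<close>.  As \<open>\<tau> n\<close> grows like \<open>ln n / s\<close>, there is no explosion.
\<close>

lemma counting_function:
  fixes \<tau> :: "nat \<Rightarrow> real" and L :: real
  assumes "\<tau> 0 = 0" and mono: "strict_mono \<tau>" and "0 < r" "0 < s"
    and L: "(\<lambda>n. ln (r + real n) - s * \<tau> n) \<longlonglongrightarrow> L"
  obtains N :: "real \<Rightarrow> nat" where "filterlim N at_top at_top"
    and "\<And>t. 0 \<le> t \<Longrightarrow> \<tau> (N t) \<le> t" "\<And>t. 0 \<le> t \<Longrightarrow> t < \<tau> (Suc (N t))"
    and "((\<lambda>t. exp (- (s * t)) * (r + real (N t))) \<longlongrightarrow> exp L) at_top"
proof -
  have "filterlim (\<lambda>n. ln (r + real n)) at_top sequentially"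
    by (intro filterlim_compose[OF ln_at_top] filterlim_tendsto_add_at_top[OF tendsto_const] filterlim_real_sequentially)
  then have "filterlim (\<lambda>n. - (ln (r + real n) - s * \<tau> n) + ln (r + real n)) at_top sequentially"
    by (intro filterlim_tendsto_add_at_top[OF tendsto_minus[OF L]])
  then have unbounded: "\<exists>n. t < \<tau> n" for t
  proof -
    have "eventually (\<lambda>n. s * t < - (ln (r + real n) - s * \<tau> n) + ln (r + real n)) sequentially"
      using \<open>filterlim (\<lambda>n. - (ln (r + real n) - s * \<tau> n) + ln (r + real n)) at_top sequentially\<close>
      by (simp add: filterlim_at_top_dense)
    then obtain n where "s * t < s * \<tau> n" by (auto simp: eventually_sequentially)
    then show ?thesis using \<open>0 < s\<close> by auto
  qed
  define N where "N t = (LEAST n. t < \<tau> (Suc n))" for t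
  have less: "t < \<tau> (Suc (N t))" for t
  proof -
    obtain n where "t < \<tau> n" using unbounded by blast
    also have "\<dots> < \<tau> (Suc n)" using mono by (simp add: strict_mono_less)
    finally show ?thesis unfolding N_def by (rule LeastI)
  qed
  have le: "\<tau> (N t) \<le> t" if "0 \<le> t" for t
  proof (cases "N t")
    case 0
    then show ?thesis using that assms(1) by simp
  next
    case (Suc n)
    then have "\<not> t < \<tau> (Suc n)" using not_less_Least[of n "\<lambda>n. t < \<tau> (Suc n)"] by (simp add: N_def)
    then show ?thesis using Suc by simp
  qed
  have N: "filterlim N at_top at_top"
  proof (subst filterlim_at_top, intro allI)
    fix k
    show "eventually (\<lambda>t. k \<le> N t) at_top"
      using eventually_ge_at_top[of "\<tau> k"]
    proof eventually_elim
      case (elim t)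
      then have "\<tau> k < \<tau> (Suc (N t))" using less[of t] by simp
      then show ?case using mono by (simp add: strict_mono_less)
    qed
  qed
  define a where "a n = exp (ln (r + real n) - s * \<tau> n)" for n
  have a: "a \<longlonglongrightarrow> exp L" unfolding a_def by (intro tendsto_intros L)
  have a_eq: "a n = exp (- (s * \<tau> n)) * (r + real n)" for n
  proof -
    have "0 < r + real n" using \<open>0 < r\<close> by simp
    then show ?thesis by (simp add: a_def exp_diff exp_minus divide_inverse mult.commute)
  qed
  define l where "l n = (r + real n) / (r + real (Suc n)) * a (Suc n)" for n
  have l: "l \<longlonglongrightarrow> exp L"
  proof -
    have "(\<lambda>n. 1 - 1 / (r + real (Suc n))) \<longlonglongrightarrow> 1 - 0"
      by (intro tendsto_diff tendsto_const tendsto_divide_0[OF tendsto_const] filterlim_at_top_imp_at_infinity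
          filterlim_tendsto_add_at_top[OF tendsto_const] filterlim_compose[OF filterlim_real_sequentially filterlim_Suc])
    moreover have "1 - 1 / (r + real (Suc n)) = (r + real n) / (r + real (Suc n))" for n
    proof -
      have "0 < r + real (Suc n)" using \<open>0 < r\<close> by simp
      then show ?thesis by (simp add: field_simps)
    qed
    ultimately have "(\<lambda>n. (r + real n) / (r + real (Suc n))) \<longlonglongrightarrow> 1" by simp
    from tendsto_mult[OF this LIMSEQ_Suc[OF a]] show ?thesis by (simp add: l_def[abs_def])
  qed
  have lim: "((\<lambda>t. exp (- (s * t)) * (r + real (N t))) \<longlongrightarrow> exp L) at_top"
  proof (rule tendsto_sandwich)
    show "((\<lambda>t. l (N t)) \<longlongrightarrow> exp L) at_top" by (rule filterlim_compose[OF l N])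
    show "((\<lambda>t. a (N t)) \<longlongrightarrow> exp L) at_top" by (rule filterlim_compose[OF a N])
    show "eventually (\<lambda>t. l (N t) \<le> exp (- (s * t)) * (r + real (N t))) at_top"
    proof (intro always_eventually allI)
      fix t
      have "0 < r + real (Suc (N t))" using \<open>0 < r\<close> by simp
      then have "l (N t) = exp (- (s * \<tau> (Suc (N t)))) * (r + real (N t))"
        by (simp add: l_def a_eq del: of_nat_Suc)
      also have "\<dots> \<le> exp (- (s * t)) * (r + real (N t))"
        using less[of t] \<open>0 < s\<close> \<open>0 < r\<close> by (intro mult_right_mono) auto
      finally show "l (N t) \<le> exp (- (s * t)) * (r + real (N t))" .
    qed
    show "eventually (\<lambda>t. exp (- (s * t)) * (r + real (N t)) \<le> a (N t)) at_top"
      using eventually_ge_at_top[of 0]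
    proof eventually_elim
      case (elim t)
      show ?case unfolding a_eq
        using le[OF elim] \<open>0 < s\<close> \<open>0 < r\<close> by (intro mult_right_mono) auto
    qed
  qed
  show thesis by (rule that[OF N le less lim])
qed

locale urn_process = urn_jump_chain m S b a c d M z0 Y T
  for m S b a c d :: int and M :: "'w measure" and z0 Y T +
  fixes U :: "real \<Rightarrow> 'w \<Rightarrow> nat \<times> nat"
  assumes U_measurable: "\<And>t. 0 \<le> t \<Longrightarrow> U t \<in> measurable M (count_space UNIV)"
    and U_path: "AE \<omega> in M. \<forall>n t. (\<Sum>i<n. T i \<omega>) \<le> t \<and> t < (\<Sum>i<Suc n. T i \<omega>) \<longrightarrow> U t \<omega> = Y n \<omega>"
begin

definition coord1 :: "real \<Rightarrow> 'w \<Rightarrow> real" where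
  "coord1 t \<omega> = exp (- (real_of_int S * t)) * u1 S (vec2 (U t \<omega>))"

definition coord2 :: "real \<Rightarrow> 'w \<Rightarrow> real" where
  "coord2 t \<omega> = exp (- (real_of_int m * t)) * form2 (U t \<omega>)"

lemma coord_measurable: "0 \<le> t \<Longrightarrow> coord1 t \<in> borel_measurable M"
  "0 \<le> t \<Longrightarrow> coord2 t \<in> borel_measurable M"
  unfolding coord1_def[abs_def] coord2_def[abs_def] using U_measurable[of t] by measurable

lemma jump_time_mono: "(\<forall>i. 0 < T i \<omega>) \<Longrightarrow> strict_mono (\<lambda>n. jump_time n \<omega>)"
  by (auto simp: strict_mono_Suc_iff jump_time_def)

lemma u1_eq: "real (balls z) = S * (r + real n) \<Longrightarrow> u1 S (vec2 z) = r + real n"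
  using S_pos by (simp add: u1_def vec2_def balls_def field_simps)

text \<open>
  The almost sure statements are gathered once: outside a null set, the process is the jump chain
  read at a counting function \<open>N\<close> that depends on the sample point.
\<close>

lemma AE_counting:
  assumes "AE \<omega> in M. (\<lambda>n. ln (r + real n) - S * jump_time n \<omega>) \<longlonglongrightarrow> L \<omega>"
  shows "AE \<omega> in M. \<exists>N :: real \<Rightarrow> nat. filterlim N at_top at_top \<and>
    (\<forall>t\<ge>0. jump_time (N t) \<omega> \<le> t \<and> U t \<omega> = Y (N t) \<omega> \<and> u1 S (vec2 (U t \<omega>)) = r + real (N t)) \<and>
    ((\<lambda>t. exp (- (real_of_int S * t)) * (r + real (N t))) \<longlongrightarrow> exp (L \<omega>)) at_top"
  using assms AE_T_pos AE_balls_Y U_path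
proof eventually_elim
  case (elim \<omega>)
  obtain N where N: "filterlim N at_top at_top"
    "\<And>t. 0 \<le> t \<Longrightarrow> jump_time (N t) \<omega> \<le> t" "\<And>t. 0 \<le> t \<Longrightarrow> t < jump_time (Suc (N t)) \<omega>"
    "((\<lambda>t. exp (- (real_of_int S * t)) * (r + real (N t))) \<longlongrightarrow> exp (L \<omega>)) at_top"
    by (rule counting_function[of "\<lambda>n. jump_time n \<omega>" r "real_of_int S" "L \<omega>"])
      (use elim jump_time_mono r_pos S_pos in \<open>auto simp: jump_time_def\<close>)
  have U: "U t \<omega> = Y (N t) \<omega>" if "0 \<le> t" for t
    using elim(4) N(2,3)[OF that] unfolding jump_time_def by blast
  show ?case using N U elim(3) by (intro exI[of _ N]) (auto intro!: u1_eq)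
qed

text \<open>
  If \<open>coord1 t \<ge> n\<close>, then the number \<open>r + N t\<close> is at least \<open>x = n * exp (S * t)\<close>, so the jump with the least index
  \<open>n0\<close> such that \<open>r + n0 \<ge> x\<close> has occurred before \<open>t\<close>; the probability of this is at most a constant
  times \<open>n powr - q\<close>, uniformly in \<open>t\<close>.
\<close>

lemma coord1_moments:
  fixes k :: nat
  shows "\<exists>C\<ge>0. \<forall>t\<ge>0. (\<integral>\<^sup>+\<omega>. ennreal (coord1 t \<omega> ^ k) \<partial>M) \<le> ennreal C"
proof -
  define q where "q = k + 2"
  define C where "C = 1 + 2 ^ k * pochhammer r q * (\<Sum>n. inverse ((real (Suc n))\<^sup>2))"
  have p: "0 \<le> pochhammer r q" using r_pos by (simp add: pochhammer_nonneg)
  obtain L where L: "AE \<omega> in M. (\<lambda>n. ln (r + real n) - S * jump_time n \<omega>) \<longlonglongrightarrow> L \<omega>"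
    by (rule jump_time_converges)
  have "(\<integral>\<^sup>+\<omega>. ennreal (coord1 t \<omega> ^ k) \<partial>M) \<le> ennreal C" if t: "0 \<le> t" for t
    unfolding C_def
  proof (rule moment_le_of_tail)
    show "coord1 t \<in> borel_measurable M" using coord_measurable t by simp
    show "AE \<omega> in M. 0 \<le> coord1 t \<omega>" using S_pos by (simp add: coord1_def u1_def vec2_def)
    fix n :: nat assume n: "0 < n"
    define x where "x = real n * exp (real_of_int S * t)"
    define n0 where "n0 = nat \<lceil>x - r\<rceil>"
    have x: "0 < x" "x \<le> r + real n0"
      using n unfolding x_def n0_def by (simp, linarith)
    have "emeasure M {\<omega> \<in> space M. real n \<le> coord1 t \<omega>} \<le> emeasure M {\<omega> \<in> space M. jump_time n0 \<omega> \<le> t}"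
    proof (rule emeasure_mono_AE)
      show "AE \<omega> in M. \<omega> \<in> {\<omega> \<in> space M. real n \<le> coord1 t \<omega>} \<longrightarrow> \<omega> \<in> {\<omega> \<in> space M. jump_time n0 \<omega> \<le> t}"
        using AE_counting[OF L] AE_T_pos
      proof eventually_elim
        case (elim \<omega>)
        then obtain N where N: "jump_time (N t) \<omega> \<le> t" "u1 S (vec2 (U t \<omega>)) = r + real (N t)"
          using t by blast
        have "n0 \<le> N t" if "real n \<le> coord1 t \<omega>"
        proof -
          have "x \<le> exp (real_of_int S * t) * coord1 t \<omega>" using that by (simp add: x_def mult.commute)
          also have "\<dots> = r + real (N t)" by (simp add: coord1_def N exp_minus)
          finally show ?thesis unfolding n0_def by (simp add: nat_le_iff ceiling_le_iff)
        qed
        then show ?case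
          using N(1) strict_mono_less_eq[OF jump_time_mono[OF elim(2)], of n0 "N t"] by auto
      qed
    qed simp
    also have "\<dots> \<le> ennreal (exp (q * (real_of_int S * t)) * pochhammer r q / (r + real n0) ^ q)"
      by (rule jump_time_tail)
    also have "\<dots> \<le> ennreal (exp (q * (real_of_int S * t)) * pochhammer r q / x ^ q)"
      using x p by (intro ennreal_leI divide_left_mono power_mono mult_pos_pos zero_less_power) auto
    also have "exp (q * (real_of_int S * t)) * pochhammer r q / x ^ q = pochhammer r q / real n ^ q"
      by (simp add: x_def power_mult_distrib exp_of_nat_mult)
    finally show "emeasure M {\<omega> \<in> space M. real n \<le> coord1 t \<omega>} \<le> ennreal (pochhammer r q / real n ^ (k + 2))"
      by (simp add: q_def)
  qed (rule p)
  moreover have "0 \<le> C"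
    unfolding C_def using p inverse_power_summable[of 2, where 'a=real]
    by (intro add_nonneg_nonneg mult_nonneg_nonneg suminf_nonneg)
      (auto intro!: summable_Suc_iff[THEN iffD2] simp del: of_nat_Suc)
  ultimately show ?thesis by blast
qed

text \<open>
  Since \<open>m = S * \<sigma>\<close>, the second coordinate at a time \<open>t\<close> with \<open>n\<close> jumps behind it is
  \<open>coord1 t powr \<sigma> * (growth n / (r + n) powr \<sigma>) * Mart n\<close>.  Its \<open>2 k\<close>-th power is bounded through
  \<open>2 * x * y \<le> x\<^sup>2 + y\<^sup>2\<close> by the \<open>4 k\<close>-th powers of \<open>1 + coord1 t\<close> and of \<open>Mart n\<close>, and the
  latter by an integrable variable that depends neither on \<open>n\<close> nor on \<open>t\<close>.
\<close>

lemma coord_limits: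
  obtains \<xi> W where "\<xi> \<in> borel_measurable M" "W \<in> borel_measurable M"
    and "AE \<omega> in M. ((\<lambda>t. coord1 t \<omega>) \<longlongrightarrow> \<xi> \<omega>) at_top"
    and "AE \<omega> in M. ((\<lambda>t. coord2 t \<omega>) \<longlongrightarrow> W \<omega>) at_top"
    and "\<And>k0::nat. \<exists>k\<ge>k0. \<exists>C\<ge>0. \<forall>t\<ge>0. (\<integral>\<^sup>+\<omega>. ennreal (coord2 t \<omega> ^ (2 * k)) \<partial>M) \<le> ennreal C"
    and "distributed M lborel \<xi> (gamma_density r)"
proof -
  obtain L where [measurable]: "L \<in> borel_measurable M"
    and L: "AE \<omega> in M. (\<lambda>n. ln (r + real n) - S * jump_time n \<omega>) \<longlonglongrightarrow> L \<omega>"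
    by (rule jump_time_converges)
  obtain W k0 D where [measurable]: "W \<in> borel_measurable M" "\<And>k::nat. D k \<in> borel_measurable M"
    and W: "AE \<omega> in M. (\<lambda>n. Mart n \<omega>) \<longlonglongrightarrow> W \<omega>"
    and D_fin: "\<And>k. k0 \<le> k \<Longrightarrow> (\<integral>\<^sup>+\<omega>. D k \<omega> \<partial>M) < \<infinity>"
    and D: "\<And>k. AE \<omega> in M. \<forall>n. ennreal (Mart n \<omega> ^ (2 * k)) \<le> D k \<omega>"
    by (rule Mart_converges) blast
  obtain c1 c2 where c2: "0 < c2" "\<And>n. growth n \<le> c2 * (r + real n) powr \<sigma>"
    using growth_bounds by metis
  define g where "g = Gamma r / Gamma (r + \<sigma>)"
  have coord2_eq: "coord2 t \<omega> = coord1 t \<omega> powr \<sigma> * (growth n / (r + real n) powr \<sigma>) * Mart n \<omega>"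
    if "U t \<omega> = Y n \<omega>" "u1 S (vec2 (U t \<omega>)) = r + real n" for t \<omega> n
  proof -
    have "0 < r + real n" using r_pos by simp
    have "exp (- (real_of_int S * t)) powr \<sigma> = exp (- (real_of_int m * t))"
      using S_pos by (simp add: powr_def \<sigma>_def)
    then have "coord1 t \<omega> powr \<sigma> = exp (- (real_of_int m * t)) * (r + real n) powr \<sigma>"
      using \<open>0 < r + real n\<close> by (simp add: coord1_def that(2) powr_mult)
    then show ?thesis
      using \<open>0 < r + real n\<close> growth_pos[of n] by (simp add: coord2_def Mart_def that(1))
  qed
  show thesis
  proof (rule that[of "\<lambda>\<omega>. exp (L \<omega>)" "\<lambda>\<omega>. exp (L \<omega>) powr \<sigma> * g * W \<omega>"])
    show "AE \<omega> in M. ((\<lambda>t. coord1 t \<omega>) \<longlongrightarrow> exp (L \<omega>)) at_top"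
      using AE_counting[OF L]
    proof eventually_elim
      case (elim \<omega>)
      then obtain N where N: "\<And>t. 0 \<le> t \<Longrightarrow> u1 S (vec2 (U t \<omega>)) = r + real (N t)"
        "((\<lambda>t. exp (- (real_of_int S * t)) * (r + real (N t))) \<longlongrightarrow> exp (L \<omega>)) at_top" by blast
      show ?case
        by (rule Lim_transform_eventually[OF N(2)])
          (use eventually_ge_at_top[of 0] in \<open>eventually_elim, simp add: coord1_def N(1)\<close>)
    qed
    show "AE \<omega> in M. ((\<lambda>t. coord2 t \<omega>) \<longlongrightarrow> exp (L \<omega>) powr \<sigma> * g * W \<omega>) at_top"
      using AE_counting[OF L] W
    proof eventually_elim
      case (elim \<omega>)
      then obtain N where N: "filterlim N at_top at_top"
        "\<And>t. 0 \<le> t \<Longrightarrow> U t \<omega> = Y (N t) \<omega>"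
        "\<And>t. 0 \<le> t \<Longrightarrow> u1 S (vec2 (U t \<omega>)) = r + real (N t)"
        "((\<lambda>t. exp (- (real_of_int S * t)) * (r + real (N t))) \<longlongrightarrow> exp (L \<omega>)) at_top" by blast
      have "((\<lambda>t. (exp (- (real_of_int S * t)) * (r + real (N t))) powr \<sigma> * (growth (N t) / (r + real (N t)) powr \<sigma>) * Mart (N t) \<omega>)
          \<longlongrightarrow> exp (L \<omega>) powr \<sigma> * g * W \<omega>) at_top"
        unfolding g_def
        by (intro tendsto_mult tendsto_powr N(4) tendsto_const filterlim_compose[OF growth_asymp N(1)]
            filterlim_compose[OF elim(2) N(1)]) simp
      then show ?case
        by (rule Lim_transform_eventually)
          (use eventually_ge_at_top[of 0] in \<open>eventually_elim, simp add: coord2_eq[OF N(2,3)] coord1_def N(3)\<close>)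
    qed
    show "distributed M lborel (\<lambda>\<omega>. exp (L \<omega>)) (gamma_density r)"
      by (rule distributed_exp_gamma[OF prob_space_axioms _ r_pos char_jump_time_limit[OF _ L]]) auto
    show "\<exists>k\<ge>k1. \<exists>C\<ge>0. \<forall>t\<ge>0. (\<integral>\<^sup>+\<omega>. ennreal (coord2 t \<omega> ^ (2 * k)) \<partial>M) \<le> ennreal C" for k1
    proof -
      define k where "k = max k0 k1"
      have k: "k0 \<le> 2 * k" "k1 \<le> k" by (auto simp: k_def)
      obtain A where A: "0 \<le> A" "\<And>t. 0 \<le> t \<Longrightarrow> (\<integral>\<^sup>+\<omega>. ennreal (coord1 t \<omega> ^ (2 * (2 * k))) \<partial>M) \<le> ennreal A"
        using coord1_moments[of "2 * (2 * k)"] by blast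
      obtain B where B: "0 \<le> B" "(\<integral>\<^sup>+\<omega>. D (2 * k) \<omega> \<partial>M) = ennreal B"
        using D_fin[OF k(1)] by (cases "(\<integral>\<^sup>+\<omega>. D (2 * k) \<omega> \<partial>M)") auto
      define c where "c = c2 ^ (2 * k)"
      have c: "0 \<le> c" using c2 by (simp add: c_def)
      define e where "e = (2 :: real) ^ (2 * (2 * k))"
      have e: "0 \<le> e" by (simp add: e_def)
      have split_ennreal: "ennreal (c * (e * (1 + z) + v)) = ennreal c * (ennreal e * (1 + ennreal z) + ennreal v)"
        if "0 \<le> z" "0 \<le> v" for z v
        using c e that by (simp add: ennreal_mult ennreal_plus)
      have "(\<integral>\<^sup>+\<omega>. ennreal (coord2 t \<omega> ^ (2 * k)) \<partial>M) \<le> ennreal (c * (e * (1 + A) + B))" if t: "0 \<le> t" for t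
      proof -
        note [measurable] = coord_measurable[OF t]
        have "(\<integral>\<^sup>+\<omega>. ennreal (coord2 t \<omega> ^ (2 * k)) \<partial>M) \<le>
            (\<integral>\<^sup>+\<omega>. ennreal c * (ennreal e * (1 + ennreal (coord1 t \<omega> ^ (2 * (2 * k)))) + D (2 * k) \<omega>) \<partial>M)"
        proof (rule nn_integral_mono_AE)
          show "AE \<omega> in M. ennreal (coord2 t \<omega> ^ (2 * k)) \<le>
              ennreal c * (ennreal e * (1 + ennreal (coord1 t \<omega> ^ (2 * (2 * k)))) + D (2 * k) \<omega>)"
            using AE_counting[OF L] D[of "2 * k"]
          proof eventually_elim
            case (elim \<omega>)
            then obtain N where N: "U t \<omega> = Y (N t) \<omega>" "u1 S (vec2 (U t \<omega>)) = r + real (N t)"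
              using t by blast
            define Z where "Z = coord1 t \<omega>"
            define V where "V = Mart (N t) \<omega>"
            define G where "G = growth (N t) / (r + real (N t)) powr \<sigma>"
            have rn: "0 < r + real (N t)" using r_pos by simp
            have Z: "0 < Z" using rn by (simp add: Z_def coord1_def N(2))
            have G: "0 \<le> G" "G \<le> c2"
              using c2(2)[of "N t"] rn growth_pos[of "N t"] by (auto simp: G_def field_simps)
            have "Z powr \<sigma> \<le> 1 + Z"
            proof (cases "Z \<le> 1")
              case True
              then have "Z powr \<sigma> \<le> 1" using Z \<sigma>_bounds by (intro powr_le1) auto
              then show ?thesis using Z by simp
            next
              case False
              then have "Z powr \<sigma> \<le> Z powr 1" using \<sigma>_bounds by (intro powr_mono) auto
              then show ?thesis using Z by simp
            qed
            then have "\<bar>coord2 t \<omega>\<bar> \<le> (1 + Z) * c2 * \<bar>V\<bar>"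
              unfolding coord2_eq[OF N] Z_def[symmetric] V_def[symmetric] G_def[symmetric] abs_mult
              using G Z by (intro mult_mono) auto
            then have "\<bar>coord2 t \<omega>\<bar> ^ (2 * k) \<le> ((1 + Z) * c2 * \<bar>V\<bar>) ^ (2 * k)"
              by (intro power_mono) auto
            also have "\<dots> = c * ((1 + Z) ^ (2 * k) * V ^ (2 * k))"
              by (simp add: c_def power_mult_distrib power_mult)
            also have "(1 + Z) ^ (2 * k) * V ^ (2 * k) \<le> (1 + Z) ^ (2 * (2 * k)) + V ^ (2 * (2 * k))"
            proof -
              have "2 * ((1 + Z) ^ (2 * k)) * V ^ (2 * k) \<le> ((1 + Z) ^ (2 * k))\<^sup>2 + (V ^ (2 * k))\<^sup>2"
                by (rule sum_squares_bound)
              moreover have "0 \<le> (1 + Z) ^ (2 * k) * V ^ (2 * k)" by (intro mult_nonneg_nonneg) auto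
              ultimately show ?thesis by (simp add: power_mult[symmetric] mult.commute)
            qed
            also have "(1 + Z) ^ (2 * (2 * k)) \<le> e * (1 + Z ^ (2 * (2 * k)))"
              using power_even_add_le[of 1 Z "2 * k"] by (simp add: e_def)
            finally have "coord2 t \<omega> ^ (2 * k) \<le> c * (e * (1 + Z ^ (2 * (2 * k))) + V ^ (2 * (2 * k)))"
              using c by (simp add: power_even_abs mult_left_mono)
            then have "ennreal (coord2 t \<omega> ^ (2 * k)) \<le>
                ennreal (c * (e * (1 + Z ^ (2 * (2 * k))) + V ^ (2 * (2 * k))))" by (rule ennreal_leI)
            also have "\<dots> = ennreal c * (ennreal e * (1 + ennreal (Z ^ (2 * (2 * k)))) + ennreal (V ^ (2 * (2 * k))))"
              by (intro split_ennreal zero_le_even_power')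
            also have "\<dots> \<le> ennreal c * (ennreal e * (1 + ennreal (Z ^ (2 * (2 * k)))) + D (2 * k) \<omega>)"
              using elim(2) by (intro mult_left_mono add_left_mono) (auto simp: V_def)
            finally show ?case by (simp add: Z_def)
          qed
        qed
        also have "\<dots> = ennreal c * (ennreal e * (1 + (\<integral>\<^sup>+\<omega>. ennreal (coord1 t \<omega> ^ (2 * (2 * k))) \<partial>M)) + ennreal B)"
          by (simp add: nn_integral_cmult nn_integral_add emeasure_space_1 B)
        also have "\<dots> \<le> ennreal c * (ennreal e * (1 + ennreal A) + ennreal B)"
          by (intro mult_left_mono add_right_mono add_left_mono A t) auto
        also have "\<dots> = ennreal (c * (e * (1 + A) + B))"
          by (rule split_ennreal[symmetric]) (use A(1) B(1) in auto)
        finally show ?thesis .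
      qed
      moreover have "0 \<le> c * (e * (1 + A) + B)"
        using c e A(1) B(1) by simp
      ultimately show ?thesis using k(2) by blast
    qed
  qed auto
qed

end

theorem theorem3p2:
  fixes m S b a c d :: int and \<alpha> \<beta> :: nat
    and M :: "'w measure" and U :: "real \<Rightarrow> 'w \<Rightarrow> nat \<times> nat"
  assumes "m + 2 \<le> S" and "S \<le> 2 * m - 1"
    and "1 \<le> b" and "b \<le> S - m - 1"
    and "a = S - b" and "c = S - m - b" and "d = m + b"
    and "(\<alpha>, \<beta>) \<noteq> (0, 0)"
    and "urn_process_CT M a b c d (\<alpha>, \<beta>) U"
  shows "\<exists>\<xi> W. \<xi> \<in> borel_measurable M \<and> W \<in> borel_measurable M \<and>
    (\<forall>t \<omega>. vec2 (U t \<omega>) =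
       u1 S (vec2 (U t \<omega>)) *\<^sub>R v1 S b c + u2 S b c (vec2 (U t \<omega>)) *\<^sub>R v2 S b c) \<and>
    converges_AE M (\<lambda>t \<omega>. exp (- S * t) * u1 S (vec2 (U t \<omega>))) \<xi> \<and>
    converges_AE M (\<lambda>t \<omega>. exp (- m * t) * u2 S b c (vec2 (U t \<omega>))) W \<and>
    (\<forall>p\<ge>1. converges_Lp M p (\<lambda>t \<omega>. exp (- S * t) * u1 S (vec2 (U t \<omega>))) \<xi>) \<and>
    (\<forall>p\<ge>1. converges_Lp M p (\<lambda>t \<omega>. exp (- m * t) * u2 S b c (vec2 (U t \<omega>))) W) \<and>
    distributed M lborel \<xi> (\<lambda>x. ennreal (gamma_density (real (\<alpha> + \<beta>) / S) x))"
proof -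
  have mjp: "markov_jump_process M (urn_rate a b c d) (\<alpha>, \<beta>) U"
    using assms(9) by (simp add: urn_process_CT_def)
  then interpret prob_space M by (simp add: markov_jump_process_def)
  from mjp obtain Y T where YT:
    "\<And>n::nat. Y n \<in> measurable M (count_space UNIV)"
    "\<And>n::nat. T n \<in> borel_measurable M"
    "\<And>n y s. (\<forall>i<n. 0 \<le> s i) \<Longrightarrow>
           measure M {\<omega> \<in> space M. (\<forall>i\<le>n. Y i \<omega> = y i) \<and> (\<forall>i<n. s i < T i \<omega>)} =
             (if y 0 = (\<alpha>, \<beta>) then 1 else 0) *
             (\<Prod>i<n. jump_prob (urn_rate a b c d) (y i) (y (Suc i)) *
               exp (- total_rate (urn_rate a b c d) (y i) * s i))"
    "AE \<omega> in M. \<forall>n t. (\<Sum>i<n. T i \<omega>) \<le> t \<and> t < (\<Sum>i<Suc n. T i \<omega>) \<longrightarrow> U t \<omega> = Y n \<omega>"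
    unfolding markov_jump_process_def by blast
  interpret urn_process m S b a c d M "(\<alpha>, \<beta>)" Y T U
    by unfold_locales (use assms YT mjp in \<open>auto simp: markov_jump_process_def\<close>)
  obtain \<xi> W where [measurable]: "\<xi> \<in> borel_measurable M" "W \<in> borel_measurable M"
    and lim1: "AE \<omega> in M. ((\<lambda>t. coord1 t \<omega>) \<longlongrightarrow> \<xi> \<omega>) at_top"
    and lim2: "AE \<omega> in M. ((\<lambda>t. coord2 t \<omega>) \<longlongrightarrow> W \<omega>) at_top"
    and mom2: "\<And>k0::nat. \<exists>k\<ge>k0. \<exists>C\<ge>0. \<forall>t\<ge>0. (\<integral>\<^sup>+\<omega>. ennreal (coord2 t \<omega> ^ (2 * k)) \<partial>M) \<le> ennreal C"
    and law: "distributed M lborel \<xi> (gamma_density r)"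
    by (rule coord_limits) blast
  have eq1: "exp (- S * t) * u1 S (vec2 (U t \<omega>)) = coord1 t \<omega>" for t :: real and \<omega>
    by (simp add: coord1_def)
  have eq2: "exp (- m * t) * u2 S b c (vec2 (U t \<omega>)) = coord2 t \<omega>" for t :: real and \<omega>
    by (simp add: coord2_def form2_def)
  have mom1: "\<exists>k\<ge>k0. \<exists>C\<ge>0. \<forall>t\<ge>0. (\<integral>\<^sup>+\<omega>. ennreal (coord1 t \<omega> ^ (2 * k)) \<partial>M) \<le> ennreal C" for k0 :: nat
    using coord1_moments by blast
  have basis: "vec2 z = u1 S (vec2 z) *\<^sub>R v1 S b c + u2 S b c (vec2 z) *\<^sub>R v2 S b c" for z
  proof -
    define x y and B C k :: real
      where "x = real (fst z)" and "y = real (snd z)" and "B = b" and "C = c" and "k = B + C"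
    note defs = this
    have nz: "real_of_int S \<noteq> 0" "k \<noteq> 0"
      using S_pos entries(2,3) by (simp_all add: defs add_pos_pos less_imp_neq[symmetric])
    have "(x + y) / S * (S / k * C) + (B * x - C * y) / S * (S / k) = ((x + y) * C + (B * x - C * y)) / k"
      "(x + y) / S * (S / k * B) + (B * x - C * y) / S * (S / k * - 1) = ((x + y) * B - (B * x - C * y)) / k"
      using nz by (simp_all add: add_divide_distrib[where c = k] diff_divide_distrib[where c = k])
    moreover have "(x + y) * C + (B * x - C * y) = x * k" "(x + y) * B - (B * x - C * y) = y * k"
      by (simp_all add: defs(5) algebra_simps)
    ultimately have "(x + y) / S * (S / k * C) + (B * x - C * y) / S * (S / k) = x"
      "(x + y) / S * (S / k * B) + (B * x - C * y) / S * (S / k * - 1) = y"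
      using nz by simp_all
    then show ?thesis
      by (simp add: prod_eq_iff vec2_def u1_def u2_def v1_def v2_def defs)
  qed
  have Lp1: "converges_Lp M p coord1 \<xi>" if "1 \<le> p" for p
    using that by (intro converges_Lp_of_bounded_even_moments coord_measurable lim1 mom1) auto
  have Lp2: "converges_Lp M p coord2 W" if "1 \<le> p" for p
    using that by (intro converges_Lp_of_bounded_even_moments coord_measurable lim2 mom2) auto
  have "r = real (\<alpha> + \<beta>) / S" by (simp add: r_def balls_def)
  then show ?thesis
    unfolding eq1 eq2 converges_AE_def
    using lim1 lim2 Lp1 Lp2 law basis by (intro exI[of _ \<xi>] exI[of _ W]) auto
qed

end
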